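(* Fix $0<\beta\le\beta_c$ (so $(\beta,K(\beta))$ is a second-order point if $\beta<\beta_c$ and the tricritical point if $\beta=\beta_c$). For each $\alpha>0$ let $(\beta_n,K_n)=(\beta_n^{(\alpha)},K_n^{(\alpha)})$, $n\in\mathbb N$, be a sequence of pairs of positive numbers converging to $(\beta,K(\beta))$. Assume the following. (i) $(\beta_n,K_n)$ lies in the phase-coexistence region for all sufficiently large $n$. (ii) The limits $b=\lim_{n\to\infty}n^{\alpha}(\beta_n-\beta)$ and $k=\lim_{n\to\infty}n^{\alpha}(K_n-K(\beta))$ both exist and are not both $0$; if $b\neq0$, then $b\in\{1,-1\}$. (iii) There exist an even polynomial $g$ of degree $4$ or $6$ with $g(x)\to\infty$ as $|x|\to\infty$, and numbers $\alpha_0>0$ and $\theta>0$, such that: (a) for all $0<\alpha<\alpha_0$, $\lim_{n\to\infty}n^{\alpha/\alpha_0}G_{\beta_n,K_n}(x/n^{\theta\alpha})=g(x)$ uniformly for $x$ in compact subsets of $\mathbb R$; (b) the set of global minimum points of $g$ equals $\{\pm\bar x\}$ for some $\bar x>0$. (iv) There exists a polynomial $H$ with $H(x)\to\infty$ as $|x|\to\infty$ such that for all $0<\alpha<\alpha_0$ there exists $R>0$ such that for all sufficiently large $n\in\mathbb N$ and all $x\in\mathbb R$ with $|x/n^{\theta\alpha}|<R$, one has $n^{\alpha/\alpha_0}G_{\beta_n,K_n}(x/n^{\theta\alpha})\ge H(x)$. Assume also that $0<\theta\alpha_0<1/2$. Then: (a) For all $0<\alpha<\alpha_0$, $E_{n,\beta_n,K_n}\{|S_n/n|\}\sim\bar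 x/n^{\theta\alpha}$, that is, $\lim_{n\to\infty}n^{\theta\alpha}E_{n,\beta_n,K_n}\{|S_n/n|\}=\bar x$. (b) For all $0<\alpha<\alpha_0$, $E_{n,\beta_n,K_n}\{|S_n/n|\}\sim m(\beta_n,K_n)$.
   Context: Mean-field Blume--Capel model. Let $\Lambda=\{1,0,-1\}$. For $n\in\mathbb N$, $K>0$ and $\omega=(\omega_1,\dots,\omega_n)\in\Lambda^n$ put $S_n(\omega)=\sum_{j=1}^n\omega_j$ and $H_{n,K}(\omega)=\sum_{j=1}^n\omega_j^2-\frac Kn\bigl(\sum_{j=1}^n\omega_j\bigr)^2$. For $\beta>0$, $P_{n,\beta,K}$ is the probability measure on $\Lambda^n$ giving $\omega$ probability proportional to $\exp[-\beta H_{n,K}(\omega)]$; $E_{n,\beta,K}$ denotes expectation with respect to $P_{n,\beta,K}$. Free-energy functional: $c_\beta(t)=\log\frac{1+e^{-\beta}(e^t+e^{-t})}{1+2e^{-\beta}}$ and $G_{\beta,K}(x)=\beta Kx^2-c_\beta(2\beta Kx)$ for $x\in\mathbb R$. $\mathcal M_{\beta,K}$ is the set of global minimum points of $G_{\beta,K}$. Let $\beta_c=\log4$ and $K(\beta)=(e^\beta+2)/(4\beta)$ for $\beta>0$. The points $(\beta,K(\beta))$ with $0<\beta<\beta_c$ are called second-order points and $(\beta_c,K(\beta_c))$ the tricritical point. The phase-coexistence region is the set of $(\beta,K)$, $\beta,K>0$, for which $\mathcal M_{\beta,K}$ has more than one element. It is known that for such $(\beta,K)$, $\mathcal M_{\beta,K}$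 is $\{\pm m(\beta,K)\}$ or $\{0,\pm m(\beta,K)\}$ with $m(\beta,K)>0$; this unique positive global minimum point $m(\beta,K)$ is the thermodynamic magnetization. Notation: $a_n\sim b_n$ means $a_n/b_n\to1$ as $n\to\infty$. The quantity $m(\beta_n,K_n)$ is considered for $n$ large enough that $(\beta_n,K_n)$ lies in the phase-coexistence region. *)

theory Defs
  imports
    "HOL-Probability.Probability"
    "HOL-Library.Landau_Symbols"
    "HOL-Computational_Algebra.Polynomial"
begin

definition spin_configs :: "nat \<Rightarrow> (nat \<Rightarrow> real) set" where
  "spin_configs n = {1..n} \<rightarrow>\<^sub>E {1, 0, -1}"

definition total_spin :: "nat \<Rightarrow> (nat \<Rightarrow> real) \<Rightarrow> real" where
  "total_spin n \<omega> = (\<Sum>j=1..n. \<omega> j)"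

definition hamiltonian :: "nat \<Rightarrow> real \<Rightarrow> (nat \<Rightarrow> real) \<Rightarrow> real" where
  "hamiltonian n K \<omega> = (\<Sum>j=1..n. (\<omega> j)\<^sup>2) - K / real n * (\<Sum>j=1..n. \<omega> j)\<^sup>2"

definition partition_fun :: "nat \<Rightarrow> real \<Rightarrow> real \<Rightarrow> real" where
  "partition_fun n \<beta> K = (\<Sum>\<omega>\<in>spin_configs n. exp (- \<beta> * hamiltonian n K \<omega>))"

definition gibbs_measure :: "nat \<Rightarrow> real \<Rightarrow> real \<Rightarrow> (nat \<Rightarrow> real) measure" where
  "gibbs_measure n \<beta> K =
     point_measure (spin_configs n)
       (\<lambda>\<omega>. ennreal (exp (- \<beta> * hamiltonian n K \<omega>) / partition_fun n \<beta> K))"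

lemma finite_spin_configs: "finite (spin_configs n)"
  unfolding spin_configs_def by (intro finite_PiE) auto

lemma spin_configs_nonempty: "spin_configs n \<noteq> {}"
  unfolding spin_configs_def by (simp add: PiE_eq_empty_iff)

lemma partition_fun_pos: "partition_fun n \<beta> K > 0"
  unfolding partition_fun_def
  by (rule sum_pos) (auto simp: finite_spin_configs spin_configs_nonempty)

lemma prob_space_gibbs_measure: "prob_space (gibbs_measure n \<beta> K)"
proof
  have "emeasure (gibbs_measure n \<beta> K) (space (gibbs_measure n \<beta> K)) =
      (\<Sum>\<omega>\<in>spin_configs n. ennreal (exp (- \<beta> * hamiltonian n K \<omega>) / partition_fun n \<beta> K))"
    unfolding gibbs_measure_def space_point_measure
    by (rule emeasure_point_measure_finite) (auto simp: finite_spin_configs)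
  also have "\<dots> = ennreal (\<Sum>\<omega>\<in>spin_configs n. exp (- \<beta> * hamiltonian n K \<omega>) / partition_fun n \<beta> K)"
    using partition_fun_pos[of n \<beta> K] by (intro sum_ennreal) auto
  also have "(\<Sum>\<omega>\<in>spin_configs n. exp (- \<beta> * hamiltonian n K \<omega>) / partition_fun n \<beta> K) = 1"
    using partition_fun_pos[of n \<beta> K]
    unfolding sum_divide_distrib[symmetric] partition_fun_def[symmetric] by simp
  finally show "emeasure (gibbs_measure n \<beta> K) (space (gibbs_measure n \<beta> K)) = 1"
    by simp
qed

definition mean_abs_spin :: "nat \<Rightarrow> real \<Rightarrow> real \<Rightarrow> real" where
  "mean_abs_spin n \<beta> K = (\<integral>\<omega>. \<bar>total_spin n \<omega> / real n\<bar> \<partial>gibbs_measure n \<beta> K)"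

definition cumulant_fun :: "real \<Rightarrow> real \<Rightarrow> real" where
  "cumulant_fun \<beta> t = ln ((1 + exp (- \<beta>) * (exp t + exp (- t))) / (1 + 2 * exp (- \<beta>)))"

definition free_energy :: "real \<Rightarrow> real \<Rightarrow> real \<Rightarrow> real" where
  "free_energy \<beta> K x = \<beta> * K * x\<^sup>2 - cumulant_fun \<beta> (2 * \<beta> * K * x)"

definition global_min_points :: "(real \<Rightarrow> real) \<Rightarrow> real set" where
  "global_min_points f = {x. \<forall>y. f x \<le> f y}"

definition beta_crit :: real where
  "beta_crit = ln 4"

definition K_crit :: "real \<Rightarrow> real" where
  "K_crit \<beta> = (exp \<beta> + 2) / (4 * \<beta>)"

definition phase_coexistence :: "(real \<times> real) set" where
  "phase_coexistence =
     {(\<beta>, K). \<beta> > 0 \<and> K > 0 \<and>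
       (\<exists>x\<in>global_min_points (free_energy \<beta> K).
        \<exists>y\<in>global_min_points (free_energy \<beta> K). x \<noteq> y)}"

text \<open>
  Meaningful only for \<open>(\<beta>, K)\<close> in the phase-coexistence region, where the positive global
  minimum point exists and is unique.
\<close>
definition magnetization :: "real \<Rightarrow> real \<Rightarrow> real" where
  "magnetization \<beta> K = (THE x. x > 0 \<and> x \<in> global_min_points (free_energy \<beta> K))"

end

theory Submission
  imports
    Defs
    "HOL-Real_Asymp.Real_Asymp"
begin

text \<open>
  Why the theorem holds. Adding to \<open>S / n\<close> an independent Gaussian of variance \<open>1 / (2 \<beta>\<^sub>n K\<^sub>n n)\<close> produces a
  random variable whose density is proportional to \<open>exp (- n G)\<close>, with \<open>G\<close> the free energy for
  \<open>(\<beta>\<^sub>n, K\<^sub>n)\<close> (\<open>gibbs_gaussian_mixture\<close>). After multiplication by \<open>n powr (\<theta> \<alpha>)\<close> the Gaussian has size of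
  order \<open>n powr (\<theta> \<alpha> - 1 / 2)\<close>, which vanishes because \<open>\<theta> \<alpha> < \<theta> \<alpha>\<^sub>0 < 1 / 2\<close>. So the rescaled spin may be studied
  through the density proportional to \<open>exp (- n G (y / n powr (\<theta> \<alpha>)))\<close> instead
  (\<open>mean_abs_spin_deviation_le\<close>).

  The exponent of this density is \<open>n powr (1 - \<alpha> / \<alpha>\<^sub>0)\<close>, which diverges, times a function that
  converges locally uniformly to \<open>g\<close>. By Laplace's method (\<open>laplace_concentration\<close>) the mass concentrates at
  the two minimum points \<open>xbar\<close> and \<open>- xbar\<close> of \<open>g\<close>, where \<open>\<bar>y\<bar> = xbar\<close>. For this the tails must be
  negligible. Up to distance \<open>R n powr (\<theta> \<alpha>)\<close> the lower bound by \<open>H\<close> controls them. Farther out one needs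
  that \<open>G\<close> is bounded below by a parabola uniformly near the critical point
  (\<open>free_energy_quadratic_lower_bound\<close>). This is where \<open>\<beta> \<le> ln 4\<close> enters: exactly then the power series of
  the single-spin moment generating function is dominated termwise by that of a Gaussian, so that
  the critical free energy is positive off the origin.

  The scaled magnetization has the same limit. It minimizes the rescaled free energy, the same tail
  bounds keep it in a bounded set, and uniform convergence forces it to \<open>xbar\<close>
  (\<open>minimizers_tendsto\<close>). That the positive minimum point is unique, and so the magnetization
  well-defined, follows because the second derivative of \<open>G\<close> vanishes only where a certain quadratic
  polynomial in \<open>cosh (2 \<beta> K x)\<close> does (\<open>free_energy_positive_minimizer_unique\<close>). The quotient of the two limits gives the
  second assertion.
\<close>

section \<open>The free energy at and near the critical curve\<close>

text \<open>
  The step from \<open>k\<close> to \<open>k + 1\<close> multiplies the left side by \<open>6 (k + 1)\<close> and the right side by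
  \<open>(2 k + 2) (2 k + 1)\<close>, which is at least as large for \<open>k \<ge> 1\<close>. The base \<open>6\<close> is \<open>exp \<beta> + 2\<close> at the
  tricritical value \<open>\<beta> = ln 4\<close>; there both \<open>k = 1\<close> and \<open>k = 2\<close> give equality.
\<close>

lemma two_six_power_fact_le: "k \<ge> 1 \<Longrightarrow> 2 * 6 ^ (k - 1) * fact k \<le> (fact (2 * k) :: real)"
proof (induction k rule: nat_induct_at_least)
  case base
  then show ?case by (simp add: fact_numeral)
next
  case (Suc k)
  have f: "fact (2 * Suc k) = (real (2*k+2) * real (2*k+1)) * (fact (2*k) :: real)"
    by (simp add: algebra_simps)
  have "2 * 6 ^ (Suc k - 1) * fact (Suc k) = (6 * (real k + 1)) * (2 * 6 ^ (k - 1) * fact k :: real)"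
    using Suc.hyps by (cases k) (auto simp: algebra_simps)
  also have "\<dots> \<le> (6 * (real k + 1)) * fact (2 * k)"
    by (intro mult_left_mono Suc.IH) auto
  also have "\<dots> \<le> (real (2*k+2) * real (2*k+1)) * fact (2*k)"
  proof (intro mult_right_mono)
    have "6 * (real k + 1) \<le> real (2*k+2) * 3" by simp
    also have "\<dots> \<le> real (2*k+2) * real (2*k+1)" using Suc.hyps by (intro mult_left_mono) auto
    finally show "6 * (real k + 1) \<le> real (2*k+2) * real (2*k+1)" .
  qed simp
  finally show ?case using f by simp
qed

lemma cosh_sums_even: "(\<lambda>k. t ^ (2 * k) / fact (2 * k)) sums cosh (t :: real)"
proof -
  have "(\<lambda>n. if even n then t ^ n /\<^sub>R fact n else 0) sums cosh t"
    by (rule cosh_converges)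
  then have "(\<lambda>k. (\<lambda>n. if even n then t ^ n /\<^sub>R fact n else 0) (2 * k)) sums cosh t"
    by (subst sums_mono_reindex[where g = "\<lambda>k::nat. 2 * k"]) (auto simp: strict_mono_def elim: evenE)
  then show ?thesis by (simp add: field_simps)
qed

text \<open>
  Both sides are power series in \<open>t\<^sup>2\<close>. Their coefficients of order \<open>0\<close> and \<open>1\<close> agree, and for \<open>a \<le> 4\<close>
  those on the left are dominated termwise. Strictness is taken from the coefficient of \<open>t\<^sup>6\<close>, the
  first one that is strictly smaller even at \<open>a = 4\<close>.
\<close>

lemma mixture_cosh_less_exp_square:
  fixes a t :: real
  assumes "0 < a" "a \<le> 4" "t \<noteq> 0"
  shows "(a + exp t + exp (- t)) / (a + 2) < exp (t\<^sup>2 / (a + 2))"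
proof -
  define u where "u k = (if k = 0 then 1 else 2 / (a + 2) * (t ^ (2 * k) / fact (2 * k)))" for k :: nat
  define v where "v k = (t\<^sup>2 / (a + 2)) ^ k /\<^sub>R fact k" for k :: nat
  have v: "v sums exp (t\<^sup>2 / (a + 2))"
    unfolding v_def by (rule exp_converges)
  have "(\<lambda>k. 2 / (a + 2) * (t ^ (2 * k) / fact (2 * k)) + (if k = 0 then 1 - 2 / (a + 2) else 0))
      sums (2 / (a + 2) * cosh t + (1 - 2 / (a + 2)))"
    by (intro sums_add sums_mult cosh_sums_even sums_single[where f="\<lambda>_. 1 - 2 / (a + 2)"])
  also have "(\<lambda>k. 2 / (a + 2) * (t ^ (2 * k) / fact (2 * k)) + (if k = 0 then 1 - 2 / (a + 2) else 0)) = u"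
    by (auto simp: u_def fun_eq_iff)
  also have "2 / (a + 2) * cosh t + (1 - 2 / (a + 2)) = (a + exp t + exp (- t)) / (a + 2)"
  proof -
    have "2 / (a + 2) * cosh t + (1 - 2 / (a + 2)) = (2 * cosh t + a) / (a + 2)"
      using assms by (simp add: divide_simps)
    then show ?thesis by (simp add: cosh_def algebra_simps)
  qed
  finally have u: "u sums ((a + exp t + exp (- t)) / (a + 2))" .
  have vk: "v k = t ^ (2 * k) / ((a + 2) ^ k * fact k)" for k
    by (simp only: v_def power_mult power_divide) (simp add: divide_inverse)
  have uk: "u k = t ^ (2 * k) / ((a + 2) * (fact (2 * k) / 2))" if "k \<ge> 1" for k
    using that assms by (simp add: u_def field_simps)
  have den: "(a + 2) ^ k * fact k \<le> (a + 2) * (fact (2 * k) / 2)" if "k \<ge> 1" for k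
  proof -
    have "(a + 2) ^ k * fact k = (a + 2) * ((a + 2) ^ (k - 1) * fact k)"
      using that by (cases k) auto
    also have "\<dots> \<le> (a + 2) * (6 ^ (k - 1) * fact k)"
      using assms by (intro mult_left_mono mult_right_mono power_mono) auto
    also have "\<dots> \<le> (a + 2) * (fact (2 * k) / 2)"
      using two_six_power_fact_le[OF that] assms by (intro mult_left_mono) auto
    finally show ?thesis .
  qed
  have le: "u k \<le> v k" for k
  proof (cases "k = 0")
    case True then show ?thesis by (simp add: u_def v_def)
  next
    case False
    then have k: "k \<ge> 1" by simp
    show ?thesis unfolding uk[OF k] vk
      using den[OF k] assms by (intro divide_left_mono mult_pos_pos) (auto simp: power_mult)
  qed
  \<comment> \<open>At \<open>k = 3\<close> the comparison reads \<open>6 (a + 2)\<^sup>2 < 360\<close>, and \<open>a \<le> 4\<close> gives \<open>6 (a + 2)\<^sup>2 \<le> 216\<close>.\<close>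
  have "(a + 2) ^ 2 \<le> 6 ^ 2" using assms by (intro power_mono) auto
  then have "(a + 2) ^ 3 * 6 < (a + 2) * 360"
    using assms mult_right_mono[of "(a + 2) ^ 2" "6 ^ 2" "a + 2"]
    by (simp add: power3_eq_cube power2_eq_square)
  then have "u 3 < v 3"
    using assms uk[of 3] unfolding vk
    by (simp only:) (intro divide_strict_left_mono mult_pos_pos, auto simp: fact_numeral)
  then have "0 < suminf (\<lambda>k. v k - u k)"
    using sums_diff[OF v u] le by (intro suminf_pos2[of _ 3]) (auto simp: sums_iff)
  also have "suminf (\<lambda>k. v k - u k) = exp (t\<^sup>2 / (a + 2)) - (a + exp t + exp (- t)) / (a + 2)"
    using sums_diff[OF v u] by (simp add: sums_iff)
  finally show ?thesis by simp
qed

lemma cumulant_args_pos: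
  "0 < 1 + exp (- b) * (exp t + exp (- t) :: real)" "0 < 1 + 2 * exp (- b :: real)"
  by (intro add_pos_pos mult_pos_pos; simp)+

text \<open>
  With \<open>a = exp \<beta>\<close> and \<open>t = 2 \<beta> K x\<close>, the choice \<open>4 \<beta> K = a + 2\<close> turns \<open>\<beta> K x\<^sup>2\<close> into \<open>t\<^sup>2 / (a + 2)\<close>, so
  this is the logarithm of the preceding inequality. It says that at second-order points and at the
  tricritical point the origin is the only global minimum point.
\<close>

lemma free_energy_pos_at_K_crit:
  assumes "0 < \<beta>" "\<beta> \<le> beta_crit" "x \<noteq> 0"
  shows "free_energy \<beta> (K_crit \<beta>) x > 0"
proof -
  define a where "a = exp \<beta>"
  have a: "0 < a" "a \<le> 4" using assms(2) exp_le_cancel_iff[of \<beta> "ln 4"] by (auto simp: a_def beta_crit_def)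
  define t where "t = 2 * \<beta> * K_crit \<beta> * x"
  have t_eq: "t = (a + 2) / 2 * x" using assms by (simp add: t_def K_crit_def a_def)
  have "t \<noteq> 0" unfolding t_eq using a assms by simp
  have q: "\<beta> * K_crit \<beta> * x\<^sup>2 = t\<^sup>2 / (a + 2)"
    using assms a unfolding t_eq K_crit_def a_def[symmetric] by (simp add: field_simps power2_eq_square)
  have "(1 + exp (- \<beta>) * (exp t + exp (- t))) / (1 + 2 * exp (- \<beta>)) = (a + exp t + exp (- t)) / (a + 2)"
  proof -
    have "1 + exp (- \<beta>) * (exp t + exp (- t)) = (a + exp t + exp (- t)) / a"
      "1 + 2 * exp (- \<beta>) = (a + 2) / a"
      using a by (simp_all add: a_def exp_minus[of \<beta>] field_simps)
    then show ?thesis using a by simp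
  qed
  also have "\<dots> < exp (t\<^sup>2 / (a + 2))"
    by (rule mixture_cosh_less_exp_square) fact+
  finally have "cumulant_fun \<beta> t < ln (exp (t\<^sup>2 / (a + 2)))"
    unfolding cumulant_fun_def by (subst ln_less_cancel_iff) (use cumulant_args_pos in \<open>auto intro!: divide_pos_pos\<close>)
  then show ?thesis unfolding free_energy_def t_def[symmetric] q by simp
qed

lemma cumulant_fun_le_abs: "cumulant_fun \<beta> t \<le> \<bar>t\<bar>"
proof -
  have "1 + exp (- \<beta>) * (exp t + exp (- t)) \<le> exp \<bar>t\<bar> + exp (- \<beta>) * (exp \<bar>t\<bar> + exp \<bar>t\<bar>)"
    by (intro add_mono mult_left_mono) auto
  then have "(1 + exp (- \<beta>) * (exp t + exp (- t))) / (1 + 2 * exp (- \<beta>)) \<le> exp \<bar>t\<bar>"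
    by (subst divide_le_eq) (auto simp: algebra_simps add_pos_pos)
  then have "cumulant_fun \<beta> t \<le> ln (exp \<bar>t\<bar>)"
    unfolding cumulant_fun_def by (subst ln_le_cancel_iff) (use cumulant_args_pos in \<open>auto intro!: divide_pos_pos\<close>)
  then show ?thesis by simp
qed

lemma free_energy_ge:
  assumes "\<beta> > 0" "K > 0"
  shows "free_energy \<beta> K x \<ge> \<beta> * K * (x\<^sup>2 - 2 * \<bar>x\<bar>)"
  using cumulant_fun_le_abs[of \<beta> "2 * \<beta> * K * x"] assms
  by (simp add: free_energy_def abs_mult algebra_simps)

lemma free_energy_0 [simp]: "free_energy \<beta> K 0 = 0"
proof -
  have "1 + exp (- \<beta>) * 2 \<noteq> (0::real)" using exp_gt_zero[of "-\<beta>"] by linarith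
  then show ?thesis by (simp add: free_energy_def cumulant_fun_def mult.commute)
qed

lemma free_energy_minus [simp]: "free_energy \<beta> K (- x) = free_energy \<beta> K x"
  by (simp add: free_energy_def cumulant_fun_def add.commute)

lemma continuous_on_free_energy [continuous_intros]:
  fixes f g h :: "'a::topological_space \<Rightarrow> real"
  assumes "continuous_on A f" "continuous_on A g" "continuous_on A h"
  shows "continuous_on A (\<lambda>x. free_energy (f x) (g x) (h x))"
proof -
  have *: "1 + exp (- b) * (exp t + exp (- t)) \<noteq> 0" "1 + 2 * exp (- b) \<noteq> 0" for b t :: real
    using cumulant_args_pos[of b] by (metis less_irrefl)+
  show ?thesis
    unfolding free_energy_def cumulant_fun_def
    by (intro continuous_intros assms ballI *) (use * in auto)
qed

text \<open>
  Outside a neighbourhood of the origin the free energy stays above a parabola, uniformly for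
  parameters near the critical point. For \<open>\<bar>x\<bar> \<ge> 4\<close> this follows from \<open>free_energy_ge\<close>, because there
  \<open>x\<^sup>2 - 2 \<bar>x\<bar> \<ge> x\<^sup>2 / 2\<close>. On the compact set \<open>R \<le> \<bar>x\<bar> \<le> 4\<close> positivity at the critical point itself
  survives small changes of the parameters by uniform continuity.
\<close>

lemma free_energy_quadratic_lower_bound:
  assumes beta: "0 < \<beta>" "\<beta> \<le> beta_crit" and R: "R > 0"
  shows "\<exists>d>0. \<forall>\<^sub>F p in nhds (\<beta>, K_crit \<beta>). \<forall>x. \<bar>x\<bar> \<ge> R \<longrightarrow> free_energy (fst p) (snd p) x \<ge> d * x\<^sup>2"
proof -
  define \<kappa> where "\<kappa> = \<beta> * K_crit \<beta>"
  have Kpos: "K_crit \<beta> > 0" using beta by (auto simp: K_crit_def intro!: divide_pos_pos add_pos_pos)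
  have \<kappa>: "\<kappa> > 0" using Kpos beta by (simp add: \<kappa>_def)
  define C where "C = {x::real. R \<le> \<bar>x\<bar> \<and> \<bar>x\<bar> \<le> 4}"
  have C: "compact C"
  proof -
    have "C = {-4..4} \<inter> {x. R \<le> \<bar>x\<bar>}" by (auto simp: C_def)
    also have "compact \<dots>" by (intro compact_Int_closed closed_Collect_le continuous_intros) auto
    finally show ?thesis .
  qed
  define E where "E = (\<lambda>q::(real \<times> real) \<times> real. free_energy (fst (fst q)) (snd (fst q)) (snd q))"
  have contE: "continuous_on A E" for A unfolding E_def by (intro continuous_intros)
  have "\<exists>\<delta>>0. \<forall>x\<in>C. E ((\<beta>, K_crit \<beta>), x) \<ge> \<delta>"
  proof (cases "C = {}")
    case True then show ?thesis by (intro exI[of _ 1]) auto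
  next
    case False
    have "continuous_on C (\<lambda>x. E ((\<beta>, K_crit \<beta>), x))" unfolding E_def by (intro continuous_intros)
    from continuous_attains_inf[OF C False this]
    obtain x where x: "x \<in> C" "\<forall>y\<in>C. E ((\<beta>, K_crit \<beta>), x) \<le> E ((\<beta>, K_crit \<beta>), y)" by blast
    have "E ((\<beta>, K_crit \<beta>), x) > 0"
      using free_energy_pos_at_K_crit[OF beta, of x] x(1) R by (auto simp: E_def C_def)
    then show ?thesis using x by blast
  qed
  then obtain \<delta> where \<delta>: "\<delta> > 0" "\<And>x. x \<in> C \<Longrightarrow> E ((\<beta>, K_crit \<beta>), x) \<ge> \<delta>" by blast
  have "uniformly_continuous_on (cball (\<beta>, K_crit \<beta>) 1 \<times> C) E"
    by (intro compact_uniformly_continuous contE compact_Times C) auto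
  from uniformly_continuous_onE[OF this half_gt_zero[OF \<delta>(1)]]
  obtain e where e: "e > 0" "\<And>q q'. q \<in> cball (\<beta>, K_crit \<beta>) 1 \<times> C \<Longrightarrow> q' \<in> cball (\<beta>, K_crit \<beta>) 1 \<times> C
      \<Longrightarrow> dist q' q < e \<Longrightarrow> dist (E q') (E q) < \<delta> / 2" by metis
  \<comment> \<open>The bound \<open>\<delta> / 2\<close> on \<open>\<bar>x\<bar> \<le> 4\<close> must be at least \<open>16 d\<close>, and the bound \<open>(\<kappa> / 2) (x\<^sup>2 / 2)\<close> beyond must be at least \<open>d x\<^sup>2\<close>.\<close>
  define d where "d = min (\<kappa> / 4) (\<delta> / 32)"
  have "\<forall>\<^sub>F p in nhds (\<beta>, K_crit \<beta>). fst p > 0"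
    using beta by (intro order_tendstoD[OF tendsto_fst[OF filterlim_ident]]) auto
  moreover have "\<forall>\<^sub>F p in nhds (\<beta>, K_crit \<beta>). snd p > 0"
    using Kpos by (intro order_tendstoD[OF tendsto_snd[OF filterlim_ident]]) auto
  moreover have "\<forall>\<^sub>F p in nhds (\<beta>, K_crit \<beta>). fst p * snd p > \<kappa> / 2"
    using \<kappa> by (intro order_tendstoD[OF tendsto_mult[OF tendsto_fst[OF filterlim_ident] tendsto_snd[OF filterlim_ident]]])
       (simp add: \<kappa>_def)
  moreover have "\<forall>\<^sub>F p in nhds (\<beta>, K_crit \<beta>). dist p (\<beta>, K_crit \<beta>) < min 1 e"
    using e(1) by (intro eventually_nhds_metric[THEN iffD2] exI[of _ "min 1 e"]) auto
  ultimately have "\<forall>\<^sub>F p in nhds (\<beta>, K_crit \<beta>). \<forall>x. \<bar>x\<bar> \<ge> R \<longrightarrow> free_energy (fst p) (snd p) x \<ge> d * x\<^sup>2"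
  proof eventually_elim
    case (elim p)
    show ?case
    proof (intro allI impI)
      fix x :: real assume xR: "\<bar>x\<bar> \<ge> R"
      show "free_energy (fst p) (snd p) x \<ge> d * x\<^sup>2"
      proof (cases "\<bar>x\<bar> \<le> 4")
        case True
        then have xC: "x \<in> C" using xR by (auto simp: C_def)
        have "dist (p, x) ((\<beta>, K_crit \<beta>), x) < e" using elim by (simp add: dist_Pair_Pair)
        then have "dist (E (p, x)) (E ((\<beta>, K_crit \<beta>), x)) < \<delta> / 2"
          using elim xC by (intro e(2)) (auto simp: dist_commute)
        then have "E (p, x) \<ge> \<delta> / 2" using \<delta>(2)[OF xC] unfolding dist_real_def by argo
        moreover have "x\<^sup>2 \<le> 16" using power_mono[OF True, of 2] by simp
        then have "d * x\<^sup>2 \<le> \<delta> / 32 * 16" using \<delta>(1) \<kappa> by (intro mult_mono) (auto simp: d_def)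
        ultimately show ?thesis by (simp add: E_def)
      next
        case False
        then have "4 * \<bar>x\<bar> \<le> \<bar>x\<bar> * \<bar>x\<bar>" by (intro mult_right_mono) auto
        then have *: "x\<^sup>2 / 2 \<le> x\<^sup>2 - 2 * \<bar>x\<bar>" by (simp add: power2_eq_square)
        have "d * x\<^sup>2 \<le> \<kappa> / 2 * (x\<^sup>2 / 2)" using mult_right_mono[of d "\<kappa> / 4" "x\<^sup>2"] by (simp add: d_def)
        also have "\<dots> \<le> fst p * snd p * (x\<^sup>2 - 2 * \<bar>x\<bar>)"
          using elim * \<kappa> by (intro mult_mono) auto
        also have "\<dots> \<le> free_energy (fst p) (snd p) x" using elim by (intro free_energy_ge)
        finally show ?thesis .
      qed
    qed
  qed
  moreover have "d > 0" using \<delta>(1) \<kappa> by (simp add: d_def)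
  ultimately show ?thesis by blast
qed

section \<open>Uniqueness of the positive minimum point\<close>

text \<open>
  Only the zeros of the derivative matter below, so it is written with the factor \<open>2 \<beta> K\<close> pulled out.
\<close>

lemma free_energy_has_derivative:
  "((\<lambda>x. free_energy \<beta> K x) has_real_derivative
     2 * \<beta> * K * (x - 2 * sinh (2 * \<beta> * K * x) / (exp \<beta> + 2 * cosh (2 * \<beta> * K * x)))) (at x)"
proof -
  define t where "t = 2 * \<beta> * K * x"
  have D: "exp \<beta> + 2 * cosh (2 * \<beta> * K * x) > 0" by (intro add_pos_pos) (auto simp: cosh_real_pos)
  have N: "1 + exp (- \<beta>) * (exp y + exp (- y)) = exp (- \<beta>) * (exp \<beta> + 2 * cosh y)" for y
    by (simp add: cosh_def algebra_simps flip: exp_add)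
  have eq: "free_energy \<beta> K = (\<lambda>x. \<beta> * K * x\<^sup>2 - (ln (exp \<beta> + 2 * cosh (2 * \<beta> * K * x)) + (- \<beta> - ln (1 + 2 * exp (- \<beta>)))))"
  proof
    fix x
    have "exp \<beta> + 2 * cosh (2 * \<beta> * K * x) > 0" by (intro add_pos_pos) (auto simp: cosh_real_pos)
    then show "free_energy \<beta> K x = \<beta> * K * x\<^sup>2 - (ln (exp \<beta> + 2 * cosh (2 * \<beta> * K * x)) + (- \<beta> - ln (1 + 2 * exp (- \<beta>))))"
      using cumulant_args_pos(2)[of \<beta>] unfolding free_energy_def cumulant_fun_def N
      by (simp add: ln_div ln_mult)
  qed
  show ?thesis unfolding eq
    apply (rule derivative_eq_intros refl D)+
    using D apply (simp add: t_def[symmetric] divide_simps)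
    apply (simp add: algebra_simps)
    done
qed

text \<open>
  The identity \<open>cosh\<^sup>2 - sinh\<^sup>2 = 1\<close> removes all hyperbolic sines from the second derivative. Hence its
  vanishing is a quadratic equation in \<open>cosh (2 \<beta> K x)\<close>.
\<close>

lemma free_energy_derivative_has_derivative:
  "((\<lambda>x. x - 2 * sinh (2 * \<beta> * K * x) / (exp \<beta> + 2 * cosh (2 * \<beta> * K * x))) has_real_derivative
     1 - 2 * \<beta> * K * (2 * exp \<beta> * cosh (2 * \<beta> * K * x) + 4) / (exp \<beta> + 2 * cosh (2 * \<beta> * K * x))\<^sup>2) (at x)"
proof -
  define t where "t = 2 * \<beta> * K * x"
  have D: "exp \<beta> + 2 * cosh t > 0" by (intro add_pos_pos) (auto simp: cosh_real_pos)
  have e: "2 * exp \<beta> * cosh t + 4 = 2 * cosh t * (exp \<beta> + 2 * cosh t) - 2 * sinh t * (2 * sinh t)"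
    using cosh_square_eq[of t] by (simp add: algebra_simps power2_eq_square)
  show ?thesis unfolding t_def[symmetric] e
    apply (rule derivative_eq_intros refl | simp add: t_def[symmetric])+
    subgoal using D by simp
    apply (rule derivative_eq_intros refl | simp add: t_def[symmetric])+
    using D apply (simp add: t_def[symmetric] divide_simps power2_eq_square)
    apply (simp add: algebra_simps)
    done
qed

lemma quadratic_three_roots_absurd:
  fixes a b c u v w :: real
  assumes "a \<noteq> 0" "u < v" "v < w"
    and "a * u\<^sup>2 + b * u + c = 0" "a * v\<^sup>2 + b * v + c = 0" "a * w\<^sup>2 + b * w + c = 0"
  shows False
proof -
  have "(u - v) * (a * (u + v) + b) = 0" "(v - w) * (a * (v + w) + b) = 0"
    using assms by (simp_all add: algebra_simps power2_eq_square)
  then have "a * (u + v) + b = 0" "a * (v + w) + b = 0" using assms by auto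
  then have "a * (w - u) = 0" by algebra
  then show False using assms by auto
qed

text \<open>
  Suppose \<open>0 < x < y\<close> are both global minimum points. They have the same value, so by Rolle there is a
  further critical point between them; together with the origin, by evenness, this makes four critical
  points on \<open>[0, y]\<close>. Rolle applied to the derivative then gives three positive zeros of the second
  derivative. As \<open>cosh\<close> is strictly increasing there, a quadratic polynomial would have three roots.
  This works for all positive parameters, in particular on both sides of \<open>\<beta>\<^sub>c\<close>.
\<close>

lemma free_energy_positive_minimizer_unique:
  assumes pos: "\<beta> > 0" "K > 0"
    and x: "x > 0" "x \<in> global_min_points (free_energy \<beta> K)"
    and y: "y > 0" "y \<in> global_min_points (free_energy \<beta> K)"
  shows "x = y"
proof -
  have *: False if xy: "0 < x" "x < y" "x \<in> global_min_points (free_energy \<beta> K)"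
    "y \<in> global_min_points (free_energy \<beta> K)" for x y
  proof -
    define G' where "G' x = x - 2 * sinh (2 * \<beta> * K * x) / (exp \<beta> + 2 * cosh (2 * \<beta> * K * x))" for x
    define G'' where "G'' x = 1 - 2 * \<beta> * K * (2 * exp \<beta> * cosh (2 * \<beta> * K * x) + 4) / (exp \<beta> + 2 * cosh (2 * \<beta> * K * x))\<^sup>2" for x
    have dG: "(free_energy \<beta> K has_real_derivative 2 * \<beta> * K * G' z) (at z)" for z
      using free_energy_has_derivative unfolding G'_def .
    have dG': "(G' has_real_derivative G'' z) (at z)" for z
      using free_energy_derivative_has_derivative unfolding G'_def G''_def .
    have crit: "G' z = 0" if "z \<in> global_min_points (free_energy \<beta> K)" for z
    proof -
      have "2 * \<beta> * K * G' z = 0"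
        using that by (intro DERIV_local_min[OF dG, of 1]) (auto simp: global_min_points_def)
      then show ?thesis using pos by simp
    qed
    have rolle: "\<exists>z. u < z \<and> z < v \<and> G'' z = 0" if "u < v" "G' u = 0" "G' v = 0" for u v
    proof -
      have "\<exists>z>u. z < v \<and> (\<lambda>h. G'' z * h) = (\<lambda>v. 0)"
        by (rule Rolle_deriv[OF that(1), where f = G'])
           (use that dG' in \<open>auto intro!: continuous_at_imp_continuous_on intro: has_derivative_continuous simp: has_field_derivative_def\<close>)
      then show ?thesis by (metis mult_cancel_left1 mult.right_neutral)
    qed
    have "\<exists>z>x. z < y \<and> (\<lambda>h. 2 * \<beta> * K * G' z * h) = (\<lambda>v. 0)"
    proof (rule Rolle_deriv[OF xy(2), where f = "free_energy \<beta> K"])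
      show "free_energy \<beta> K x = free_energy \<beta> K y"
        using xy by (auto simp: global_min_points_def intro: antisym)
    qed (use dG in \<open>auto intro!: continuous_at_imp_continuous_on intro: has_derivative_continuous simp: has_field_derivative_def\<close>)
    then obtain z where z: "x < z" "z < y" "2 * \<beta> * K * G' z = 0"
      by (metis mult.right_neutral)
    have "G' z = 0" using z pos by simp
    have "G' 0 = 0" by (simp add: G'_def)
    obtain p where p: "0 < p" "p < x" "G'' p = 0" using rolle[of 0 x] xy crit \<open>G' 0 = 0\<close> by blast
    obtain q where q: "x < q" "q < z" "G'' q = 0" using rolle[of x z] xy crit \<open>G' z = 0\<close> z by blast
    obtain r where r: "z < r" "r < y" "G'' r = 0" using rolle[of z y] xy crit \<open>G' z = 0\<close> z by blast
    define a where "a = exp \<beta>"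
    have quad: "4 * (cosh (2 * \<beta> * K * t))\<^sup>2 + (4 * a - 4 * \<beta> * K * a) * cosh (2 * \<beta> * K * t) + (a\<^sup>2 - 8 * \<beta> * K) = 0"
      if "G'' t = 0" for t
    proof -
      have "exp \<beta> + 2 * cosh (2 * \<beta> * K * t) > 0" by (intro add_pos_pos) (auto simp: cosh_real_pos)
      then have "2 * \<beta> * K * (2 * a * cosh (2 * \<beta> * K * t) + 4) = (a + 2 * cosh (2 * \<beta> * K * t))\<^sup>2"
        using that by (simp add: G''_def a_def divide_eq_eq)
      then show ?thesis by (simp add: power2_eq_square algebra_simps)
    qed
    have mono: "cosh (2 * \<beta> * K * s) < cosh (2 * \<beta> * K * t)" if "0 < s" "s < t" for s t
      using that pos by (intro cosh_real_strict_mono) auto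
    show False
      by (rule quadratic_three_roots_absurd[OF _ mono mono quad[OF p(3)] quad[OF q(3)] quad[OF r(3)]])
         (use p q r in auto)
  qed
  show ?thesis using *[of x y] *[of y x] x y by (cases x y rule: linorder_cases) auto
qed

text \<open>
  Two different minimum points cannot both be \<open>0\<close>; the absolute value of a nonzero one is again a
  minimum point by evenness, and it is the only positive one. So the definite description in
  \<open>magnetization\<close> denotes.
\<close>

lemma magnetization_phase_coexistence:
  assumes "(\<beta>, K) \<in> phase_coexistence"
  shows "magnetization \<beta> K > 0" "magnetization \<beta> K \<in> global_min_points (free_energy \<beta> K)"
proof -
  have pos: "\<beta> > 0" "K > 0" using assms by (auto simp: phase_coexistence_def)
  obtain x y where xy: "x \<in> global_min_points (free_energy \<beta> K)" "y \<in> global_min_points (free_energy \<beta> K)" "x \<noteq> y"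
    using assms by (auto simp: phase_coexistence_def)
  then obtain z where z: "z \<in> global_min_points (free_energy \<beta> K)" "z \<noteq> 0" by metis
  then have "\<bar>z\<bar> \<in> global_min_points (free_energy \<beta> K)"
    by (auto simp: global_min_points_def abs_if)
  then have "\<exists>!x. x > 0 \<and> x \<in> global_min_points (free_energy \<beta> K)"
    using z free_energy_positive_minimizer_unique[OF pos] by (intro ex1I[of _ "\<bar>z\<bar>"]) auto
  from theI'[OF this] show "magnetization \<beta> K > 0" "magnetization \<beta> K \<in> global_min_points (free_energy \<beta> K)"
    by (auto simp: magnetization_def)
qed

section \<open>The Gibbs measure as a Gaussian mixture\<close>

abbreviation gibbs_weight :: "nat \<Rightarrow> real \<Rightarrow> real \<Rightarrow> (nat \<Rightarrow> real) \<Rightarrow> real" where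
  "gibbs_weight n \<beta> K \<omega> \<equiv> exp (- \<beta> * hamiltonian n K \<omega>) / partition_fun n \<beta> K"

lemma mean_abs_spin_eq_sum:
  "mean_abs_spin n \<beta> K = (\<Sum>\<omega>\<in>spin_configs n. gibbs_weight n \<beta> K \<omega> * \<bar>total_spin n \<omega> / real n\<bar>)"
  unfolding mean_abs_spin_def gibbs_measure_def
  by (subst lebesgue_integral_point_measure_finite)
     (auto simp: finite_spin_configs intro!: divide_nonneg_pos partition_fun_pos)

lemma sum_gibbs_weight: "(\<Sum>\<omega>\<in>spin_configs n. gibbs_weight n \<beta> K \<omega>) = 1"
  using partition_fun_pos[of n \<beta> K]
  unfolding sum_divide_distrib[symmetric] partition_fun_def[symmetric] by simp

text \<open>
  Once the interaction has been linearized, the spins are independent and the sum over all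
  configurations factorizes.
\<close>

lemma sum_spin_configs_product:
  "(\<Sum>\<omega>\<in>spin_configs n. exp (t * total_spin n \<omega> - \<beta> * (\<Sum>j=1..n. (\<omega> j)\<^sup>2)))
     = (1 + exp (- \<beta>) * (exp t + exp (- t))) ^ n"
proof -
  have "(\<Sum>\<omega>\<in>spin_configs n. exp (t * total_spin n \<omega> - \<beta> * (\<Sum>j=1..n. (\<omega> j)\<^sup>2)))
      = (\<Sum>\<omega>\<in>spin_configs n. \<Prod>j\<in>{1..n}. exp (t * \<omega> j - \<beta> * (\<omega> j)\<^sup>2))"
    by (simp add: total_spin_def sum_distrib_left sum_subtractf exp_sum flip: sum_subtractf)
  also have "\<dots> = (\<Prod>j\<in>{1..n}. \<Sum>v\<in>{1, 0, -1}. exp (t * v - \<beta> * v\<^sup>2))"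
    unfolding spin_configs_def by (rule prod_sum_PiE[symmetric]) auto
  also have "\<dots> = (1 + exp (- \<beta>) * (exp t + exp (- t))) ^ n"
    by (simp add: distrib_left add_ac exp_add exp_diff exp_minus field_simps)
  finally show ?thesis .
qed

lemma cumulant_fun_exp: "exp (real n * cumulant_fun \<beta> t) =
   (1 + exp (- \<beta>) * (exp t + exp (- t))) ^ n / (1 + 2 * exp (- \<beta>)) ^ n"
  using cumulant_args_pos(1)[of \<beta> t] cumulant_args_pos(2)[of \<beta>]
  by (simp add: cumulant_fun_def exp_of_nat_mult power_divide)

text \<open>
  The Hubbard--Stratonovich transformation. If \<open>S / n\<close> is drawn from the Gibbs measure and an independent
  centred Gaussian of variance \<open>1 / (2 \<beta> K n)\<close> is added, the density of the result is proportional to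
  \<open>exp (- n G)\<close>: completing the square in the Gaussian exponent cancels the quadratic interaction
  \<open>\<beta> K S\<^sup>2 / n\<close>, and what remains is linear in \<open>S\<close>. The identity is stated for the rescaled variable
  \<open>s S / n\<close>, so that no change of variables is required later.
\<close>

lemma gibbs_gaussian_mixture:
  assumes n: "n \<ge> 1" and pos: "\<beta> > 0" "K > 0" "s > 0"
  shows "\<exists>C>0. \<forall>y. (\<Sum>\<omega>\<in>spin_configs n. gibbs_weight n \<beta> K \<omega> *
            normal_density (s * (total_spin n \<omega> / real n)) (s / sqrt (2 * \<beta> * K * real n)) y)
          = C * exp (- real n * free_energy \<beta> K (y / s))"
proof (intro exI conjI allI)
  define \<sigma> where "\<sigma> = s / sqrt (2 * \<beta> * K * real n)"
  define c where "c = 1 / sqrt (2 * pi * \<sigma>\<^sup>2) / partition_fun n \<beta> K"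
  have \<sigma>: "\<sigma> > 0" "\<sigma>\<^sup>2 = s\<^sup>2 / (2 * \<beta> * K * real n)"
    using n pos by (auto simp: \<sigma>_def power_divide)
  show "c * (1 + 2 * exp (- \<beta>)) ^ n > 0"
    using \<sigma>(1) cumulant_args_pos(2)[of \<beta>] partition_fun_pos[of n \<beta> K]
    by (auto simp: c_def intro!: mult_pos_pos divide_pos_pos)
  fix y
  define x where "x = y / s"
  have y: "y = s * x" using pos by (simp add: x_def)
  have term_eq: "gibbs_weight n \<beta> K \<omega> * normal_density (s * (total_spin n \<omega> / real n)) \<sigma> y =
     c * exp (- real n * (\<beta> * K * x\<^sup>2)) *
       exp (2 * \<beta> * K * x * total_spin n \<omega> - \<beta> * (\<Sum>j=1..n. (\<omega> j)\<^sup>2))" for \<omega>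
  proof -
    define S Q where "S = total_spin n \<omega>" and "Q = (\<Sum>j=1..n. (\<omega> j)\<^sup>2)"
    have H: "hamiltonian n K \<omega> = Q - K / real n * S\<^sup>2"
      by (simp add: hamiltonian_def S_def Q_def total_spin_def)
    have "(y - s * (S / real n))\<^sup>2 / (2 * \<sigma>\<^sup>2) = \<beta> * K * real n * (x - S / real n)\<^sup>2"
      unfolding y \<sigma>(2) using pos n by (simp add: field_simps power2_eq_square)
    also have "\<dots> = real n * (\<beta> * K * x\<^sup>2) - 2 * \<beta> * K * x * S + \<beta> * (K / real n * S\<^sup>2)"
      using n by (simp add: field_simps power2_eq_square)
    finally have q: "- (y - s * (S / real n))\<^sup>2 / (2 * \<sigma>\<^sup>2) =
      - real n * (\<beta> * K * x\<^sup>2) + 2 * \<beta> * K * x * S - \<beta> * (K / real n * S\<^sup>2)" by simp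
    have "exp (- \<beta> * hamiltonian n K \<omega>) * exp (- (y - s * (S / real n))\<^sup>2 / (2 * \<sigma>\<^sup>2))
      = exp (- real n * (\<beta> * K * x\<^sup>2)) * exp (2 * \<beta> * K * x * S - \<beta> * Q)"
      unfolding q H by (simp add: algebra_simps flip: exp_add)
    then show ?thesis
      unfolding normal_density_def c_def S_def[symmetric] Q_def[symmetric] by simp
  qed
  have "(\<Sum>\<omega>\<in>spin_configs n. gibbs_weight n \<beta> K \<omega> * normal_density (s * (total_spin n \<omega> / real n)) \<sigma> y)
    = c * exp (- real n * (\<beta> * K * x\<^sup>2)) * (1 + exp (- \<beta>) * (exp (2 * \<beta> * K * x) + exp (- (2 * \<beta> * K * x)))) ^ n"
    unfolding term_eq sum_distrib_left[symmetric] sum_spin_configs_product ..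
  also have "(1 + exp (- \<beta>) * (exp (2 * \<beta> * K * x) + exp (- (2 * \<beta> * K * x)))) ^ n =
      (1 + 2 * exp (- \<beta>)) ^ n * exp (real n * cumulant_fun \<beta> (2 * \<beta> * K * x))"
    using cumulant_args_pos(2)[of \<beta>] unfolding cumulant_fun_exp by simp
  also have "c * exp (- real n * (\<beta> * K * x\<^sup>2)) * \<dots> = c * (1 + 2 * exp (- \<beta>)) ^ n * exp (- real n * free_energy \<beta> K x)"
    by (simp add: free_energy_def algebra_simps flip: exp_add)
  finally show "(\<Sum>\<omega>\<in>spin_configs n. gibbs_weight n \<beta> K \<omega> *
            normal_density (s * (total_spin n \<omega> / real n)) (s / sqrt (2 * \<beta> * K * real n)) y)
          = c * (1 + 2 * exp (- \<beta>)) ^ n * exp (- real n * free_energy \<beta> K (y / s))"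
    by (simp add: \<sigma>_def x_def)
qed

text \<open>
  Integrating the mixture identity transfers the deviation of \<open>s \<bar>S / n\<bar>\<close> from \<open>c\<close> to the density
  proportional to \<open>q\<close>. The price is the mean absolute value of the added Gaussian, which is its standard
  deviation times \<open>sqrt (2 / pi)\<close>. Integrability of \<open>q\<close> comes from the same identity, since \<open>q\<close> is a finite
  combination of Gaussian densities.
\<close>

lemma mean_abs_spin_deviation_le:
  assumes n: "n \<ge> 1" and pos: "\<beta> > 0" "K > 0" "s > 0"
  defines "q \<equiv> \<lambda>y. exp (- real n * free_energy \<beta> K (y / s))"
  shows "integrable lborel q"
    and "integrable lborel (\<lambda>y. \<bar>y\<bar> * q y)"
    and "\<bar>s * mean_abs_spin n \<beta> K - c\<bar>
      \<le> (\<integral>y. \<bar>\<bar>y\<bar> - c\<bar> * q y \<partial>lborel) / (\<integral>y. q y \<partial>lborel)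
        + s / sqrt (2 * \<beta> * K * real n) * sqrt (2 / pi)"
proof -
  define \<sigma> where "\<sigma> = s / sqrt (2 * \<beta> * K * real n)"
  define w where "w = gibbs_weight n \<beta> K"
  define \<mu> where "\<mu> \<omega> = s * (total_spin n \<omega> / real n)" for \<omega>
  define N where "N \<omega> = normal_density (\<mu> \<omega>) \<sigma>" for \<omega>
  have \<sigma>: "\<sigma> > 0" using n pos by (simp add: \<sigma>_def)
  have w: "w \<omega> \<ge> 0" for \<omega> using partition_fun_pos[of n \<beta> K] by (simp add: w_def)
  have sw: "(\<Sum>\<omega>\<in>spin_configs n. w \<omega>) = 1" unfolding w_def by (rule sum_gibbs_weight)
  obtain C where C: "C > 0" "\<And>y. (\<Sum>\<omega>\<in>spin_configs n. w \<omega> * N \<omega> y) = C * q y"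
    using gibbs_gaussian_mixture[OF n pos] unfolding w_def N_def \<mu>_def \<sigma>_def q_def by blast
  have N0: "N \<omega> y \<ge> 0" for \<omega> y by (simp add: N_def normal_density_nonneg)
  have N_int [simp]: "integrable lborel (N \<omega>)" "integral\<^sup>L lborel (N \<omega>) = 1" for \<omega>
    using \<sigma> by (simp_all add: N_def)
  have N_dev: "has_bochner_integral lborel (\<lambda>y. N \<omega> y * \<bar>y - \<mu> \<omega>\<bar>) (\<sigma> * sqrt (2 / pi))" for \<omega>
    using normal_moment_abs_odd[OF \<sigma>, of "\<mu> \<omega>" 0] by (simp add: N_def)
  have N_abs: "integrable lborel (\<lambda>y. N \<omega> y * \<bar>y\<bar>)" for \<omega>
    using integrable_abs[OF integrable_normal_moment_nz_1[OF \<sigma>, of "\<mu> \<omega>"]] N0[of \<omega>]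
    by (simp add: N_def abs_mult)
  have q_eq: "q y = (\<Sum>\<omega>\<in>spin_configs n. w \<omega> * N \<omega> y) / C" for y
    using C by simp
  show q_int: "integrable lborel q"
    unfolding q_eq by (intro integrable_divide Bochner_Integration.integrable_sum integrable_mult_right) simp
  have "(\<lambda>y. \<bar>y\<bar> * q y) = (\<lambda>y. (\<Sum>\<omega>\<in>spin_configs n. w \<omega> * (N \<omega> y * \<bar>y\<bar>)) / C)"
    by (simp add: q_eq sum_distrib_left mult_ac)
  moreover have "integrable lborel \<dots>"
    by (intro integrable_divide Bochner_Integration.integrable_sum integrable_mult_right N_abs)
  ultimately show qa_int: "integrable lborel (\<lambda>y. \<bar>y\<bar> * q y)" by simp
  have "C * integral\<^sup>L lborel q = (\<integral>y. (\<Sum>\<omega>\<in>spin_configs n. w \<omega> * N \<omega> y) \<partial>lborel)"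
    by (simp add: C)
  also have "\<dots> = 1"
    by (subst Bochner_Integration.integral_sum) (auto simp: sw)
  finally have C_eq: "C = 1 / integral\<^sup>L lborel q" using C(1) by (metis eq_divide_eq mult_zero_right zero_neq_one)
  have dev_int: "integrable lborel (\<lambda>y. N \<omega> y * \<bar>\<bar>y\<bar> - c\<bar>)" for \<omega>
  proof (rule Bochner_Integration.integrable_bound)
    show "integrable lborel (\<lambda>y. N \<omega> y * \<bar>y\<bar> + \<bar>c\<bar> * N \<omega> y)" using N_abs by simp
    show "(\<lambda>y. N \<omega> y * \<bar>\<bar>y\<bar> - c\<bar>) \<in> borel_measurable lborel" by (simp add: N_def)
    show "AE y in lborel. norm (N \<omega> y * \<bar>\<bar>y\<bar> - c\<bar>) \<le> norm (N \<omega> y * \<bar>y\<bar> + \<bar>c\<bar> * N \<omega> y)"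
    proof (rule AE_I2)
      fix y
      have "N \<omega> y * \<bar>\<bar>y\<bar> - c\<bar> \<le> N \<omega> y * (\<bar>y\<bar> + \<bar>c\<bar>)" using N0 by (intro mult_left_mono) auto
      then show "norm (N \<omega> y * \<bar>\<bar>y\<bar> - c\<bar>) \<le> norm (N \<omega> y * \<bar>y\<bar> + \<bar>c\<bar> * N \<omega> y)"
        using N0[of \<omega> y] by (simp add: abs_mult algebra_simps)
    qed
  qed
  have single: "\<bar>\<bar>\<mu> \<omega>\<bar> - c\<bar> \<le> (\<integral>y. N \<omega> y * \<bar>\<bar>y\<bar> - c\<bar> \<partial>lborel) + \<sigma> * sqrt (2 / pi)" for \<omega>
  proof -
    have "\<bar>\<bar>\<mu> \<omega>\<bar> - c\<bar> = (\<integral>y. N \<omega> y * \<bar>\<bar>\<mu> \<omega>\<bar> - c\<bar> \<partial>lborel)" by simp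
    also have "\<dots> \<le> (\<integral>y. N \<omega> y * \<bar>\<bar>y\<bar> - c\<bar> + N \<omega> y * \<bar>y - \<mu> \<omega>\<bar> \<partial>lborel)"
    proof (rule integral_mono)
      show "integrable lborel (\<lambda>y. N \<omega> y * \<bar>\<bar>y\<bar> - c\<bar> + N \<omega> y * \<bar>y - \<mu> \<omega>\<bar>)"
        using dev_int N_dev[THEN integrable.intros] by auto
      fix y
      show "N \<omega> y * \<bar>\<bar>\<mu> \<omega>\<bar> - c\<bar> \<le> N \<omega> y * \<bar>\<bar>y\<bar> - c\<bar> + N \<omega> y * \<bar>y - \<mu> \<omega>\<bar>"
        unfolding distrib_left[symmetric] using N0 by (intro mult_left_mono) auto
    qed simp
    also have "\<dots> = (\<integral>y. N \<omega> y * \<bar>\<bar>y\<bar> - c\<bar> \<partial>lborel) + \<sigma> * sqrt (2 / pi)"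
      using dev_int N_dev[THEN integrable.intros] has_bochner_integral_integral_eq[OF N_dev, of \<omega>]
      by (subst Bochner_Integration.integral_add) auto
    finally show ?thesis .
  qed
  have "s * mean_abs_spin n \<beta> K = (\<Sum>\<omega>\<in>spin_configs n. w \<omega> * \<bar>\<mu> \<omega>\<bar>)"
    using pos unfolding mean_abs_spin_eq_sum w_def \<mu>_def by (simp add: sum_distrib_left abs_mult mult_ac)
  then have "s * mean_abs_spin n \<beta> K - c = (\<Sum>\<omega>\<in>spin_configs n. w \<omega> * (\<bar>\<mu> \<omega>\<bar> - c))"
    using sw by (simp add: right_diff_distrib sum_subtractf flip: sum_distrib_right)
  also have "\<bar>\<dots>\<bar> \<le> (\<Sum>\<omega>\<in>spin_configs n. w \<omega> * \<bar>\<bar>\<mu> \<omega>\<bar> - c\<bar>)"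
    by (rule order.trans[OF sum_abs]) (simp add: abs_mult w)
  also have "\<dots> \<le> (\<Sum>\<omega>\<in>spin_configs n. w \<omega> * ((\<integral>y. N \<omega> y * \<bar>\<bar>y\<bar> - c\<bar> \<partial>lborel) + \<sigma> * sqrt (2 / pi)))"
    by (intro sum_mono mult_left_mono single w)
  also have "\<dots> = (\<Sum>\<omega>\<in>spin_configs n. w \<omega> * (\<integral>y. N \<omega> y * \<bar>\<bar>y\<bar> - c\<bar> \<partial>lborel)) + \<sigma> * sqrt (2 / pi)"
    using sw by (simp add: distrib_left sum.distrib flip: sum_distrib_right)
  also have "(\<Sum>\<omega>\<in>spin_configs n. w \<omega> * (\<integral>y. N \<omega> y * \<bar>\<bar>y\<bar> - c\<bar> \<partial>lborel))
      = (\<integral>y. (\<Sum>\<omega>\<in>spin_configs n. w \<omega> * (N \<omega> y * \<bar>\<bar>y\<bar> - c\<bar>)) \<partial>lborel)"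
    using dev_int by (subst Bochner_Integration.integral_sum) auto
  also have "\<dots> = (\<integral>y. C * (\<bar>\<bar>y\<bar> - c\<bar> * q y) \<partial>lborel)"
  proof (rule Bochner_Integration.integral_cong[OF refl])
    fix y
    have "(\<Sum>\<omega>\<in>spin_configs n. w \<omega> * (N \<omega> y * \<bar>\<bar>y\<bar> - c\<bar>)) = (\<Sum>\<omega>\<in>spin_configs n. w \<omega> * N \<omega> y) * \<bar>\<bar>y\<bar> - c\<bar>"
      unfolding sum_distrib_right by (simp add: mult.assoc)
    then show "(\<Sum>\<omega>\<in>spin_configs n. w \<omega> * (N \<omega> y * \<bar>\<bar>y\<bar> - c\<bar>)) = C * (\<bar>\<bar>y\<bar> - c\<bar> * q y)"
      by (simp add: C mult_ac)
  qed
  also have "\<dots> = (\<integral>y. \<bar>\<bar>y\<bar> - c\<bar> * q y \<partial>lborel) / integral\<^sup>L lborel q"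
    by (simp add: C_eq)
  finally show "\<bar>s * mean_abs_spin n \<beta> K - c\<bar>
      \<le> (\<integral>y. \<bar>\<bar>y\<bar> - c\<bar> * q y \<partial>lborel) / (\<integral>y. q y \<partial>lborel)
        + s / sqrt (2 * \<beta> * K * real n) * sqrt (2 / pi)"
    by (simp add: \<sigma>_def)
qed

section \<open>Laplace's method\<close>

lemma minimizer_gap:
  fixes g :: "real \<Rightarrow> real"
  assumes "continuous_on UNIV g" "compact C" "x \<in> global_min_points g" "C \<inter> global_min_points g = {}"
  shows "\<exists>\<delta>>0. \<forall>y\<in>C. g y \<ge> g x + \<delta>"
proof (cases "C = {}")
  case True then show ?thesis by (intro exI[of _ 1]) auto
next
  case False
  obtain z where z: "z \<in> C" "\<forall>y\<in>C. g z \<le> g y"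
    using continuous_attains_inf[OF assms(2) False continuous_on_subset[OF assms(1) subset_UNIV]] by blast
  have "z \<notin> global_min_points g" using assms(4) z(1) by blast
  then obtain w where "g w < g z" by (auto simp: global_min_points_def not_le)
  moreover have "g x \<le> g w" using assms(3) by (simp add: global_min_points_def)
  ultimately have "g x < g z" by simp
  then show ?thesis using z(2) by (intro exI[of _ "g z - g x"]) auto
qed

text \<open>
  On a bounded part of the half-line and away from \<open>xbar\<close>, the limit exceeds its minimum by a fixed
  amount. Uniform convergence preserves this, so a point at which \<open>F n\<close> is no larger than at \<open>xbar\<close>
  cannot lie there.
\<close>

lemma minimizers_tendsto:
  fixes F :: "nat \<Rightarrow> real \<Rightarrow> real" and g :: "real \<Rightarrow> real"
  assumes unif: "\<And>C. compact C \<Longrightarrow> uniform_limit C F g sequentially"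
    and cont: "continuous_on UNIV g"
    and xbar: "xbar > 0" "global_min_points g = {xbar, - xbar}"
    and y: "\<forall>\<^sub>F n in sequentially. 0 \<le> y n \<and> y n \<le> M \<and> F n (y n) \<le> F n xbar"
  shows "y \<longlonglongrightarrow> xbar"
proof (rule tendstoI)
  fix \<epsilon> :: real assume "\<epsilon> > 0"
  define C where "C = {0..M} \<inter> {y. \<epsilon> \<le> \<bar>y - xbar\<bar>}"
  have C: "compact C"
    unfolding C_def by (intro compact_Int_closed closed_Collect_le continuous_intros) auto
  have "C \<inter> global_min_points g = {}" using xbar \<open>\<epsilon> > 0\<close> by (auto simp: C_def)
  then obtain \<delta> where \<delta>: "\<delta> > 0" "\<And>y. y \<in> C \<Longrightarrow> g y \<ge> g xbar + \<delta>"
    using minimizer_gap[OF cont C, of xbar] xbar by auto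
  have "compact (insert xbar C)" using C by auto
  from uniform_limitD[OF unif[OF this] half_gt_zero[OF \<delta>(1)]] y
  show "\<forall>\<^sub>F n in sequentially. dist (y n) xbar < \<epsilon>"
  proof eventually_elim
    case (elim n)
    have "y n \<notin> C"
    proof
      assume "y n \<in> C"
      then have "dist (F n (y n)) (g (y n)) < \<delta> / 2" "dist (F n xbar) (g xbar) < \<delta> / 2"
        "g (y n) \<ge> g xbar + \<delta>" using elim \<delta> by auto
      then show False using elim unfolding dist_real_def by argo
    qed
    then show ?case using elim by (auto simp: C_def dist_real_def)
  qed
qed

text \<open>
  Laplace's method with functions \<open>F n\<close> that vary with \<open>n\<close>. Mass at distance at least \<open>\<epsilon>\<close> from
  \<open>{xbar, - xbar}\<close> inside \<open>[- M, M]\<close> carries a factor \<open>exp (- p n (g xbar + \<delta>))\<close>, whereas a neighbourhood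
  of \<open>xbar\<close> contributes at least a constant times \<open>exp (- p n (g xbar + \<delta> / 2))\<close> to the normalization.
  Since \<open>g xbar < 0\<close>, that contribution is even bounded below by a positive constant, so a tail integral
  that merely tends to \<open>0\<close> is harmless.
\<close>

lemma laplace_concentration:
  fixes F :: "nat \<Rightarrow> real \<Rightarrow> real" and g :: "real \<Rightarrow> real" and p :: "nat \<Rightarrow> real"
  defines "q \<equiv> \<lambda>n y. exp (- p n * F n y)"
  assumes unif: "\<And>C. compact C \<Longrightarrow> uniform_limit C F g sequentially"
    and cont: "continuous_on UNIV g"
    and xbar: "xbar > 0" "global_min_points g = {xbar, - xbar}" "g xbar < 0"
    and p: "filterlim p at_top sequentially"
    and int: "\<forall>\<^sub>F n in sequentially. integrable lborel (q n) \<and> integrable lborel (\<lambda>y. \<bar>y\<bar> * q n y)"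
    and M: "M > 0"
    and tail: "(\<lambda>n. \<integral>y. indicator {y. \<bar>y\<bar> > M} y * ((\<bar>y\<bar> + xbar) * q n y) \<partial>lborel) \<longlonglongrightarrow> 0"
  shows "(\<lambda>n. (\<integral>y. \<bar>\<bar>y\<bar> - xbar\<bar> * q n y \<partial>lborel) / (\<integral>y. q n y \<partial>lborel)) \<longlonglongrightarrow> 0"
proof (rule tendstoI)
  fix \<epsilon>0 :: real assume "\<epsilon>0 > 0"
  define \<epsilon> where "\<epsilon> = \<epsilon>0 / 2"
  have \<epsilon>: "\<epsilon> > 0" using \<open>\<epsilon>0 > 0\<close> by (simp add: \<epsilon>_def)
  define C where "C = {-M..M} \<inter> {y. \<epsilon> \<le> \<bar>\<bar>y\<bar> - xbar\<bar>}"
  have C: "compact C"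
    unfolding C_def by (intro compact_Int_closed closed_Collect_le continuous_intros) auto
  have "C \<inter> global_min_points g = {}" using xbar \<open>\<epsilon> > 0\<close> by (auto simp: C_def)
  then obtain \<delta>0 where \<delta>0: "\<delta>0 > 0" "\<And>y. y \<in> C \<Longrightarrow> g y \<ge> g xbar + \<delta>0"
    using minimizer_gap[OF cont C, of xbar] xbar by auto
  \<comment> \<open>Small enough that \<open>g xbar + \<delta> / 2\<close> is still nonpositive.\<close>
  define \<delta> where "\<delta> = min \<delta>0 (- g xbar) / 2"
  have \<delta>: "\<delta> > 0" "\<And>y. y \<in> C \<Longrightarrow> g y \<ge> g xbar + 2 * \<delta>" "g xbar + \<delta> / 2 \<le> 0"
  proof -
    show "\<delta> > 0" "g xbar + \<delta> / 2 \<le> 0" using \<delta>0(1) xbar(3) by (auto simp: \<delta>_def)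
    fix y assume "y \<in> C"
    from \<delta>0(2)[OF this] show "g y \<ge> g xbar + 2 * \<delta>" by (simp add: \<delta>_def)
  qed
  have "isCont g xbar" using cont by (simp add: continuous_on_eq_continuous_at)
  then obtain \<eta>0 where \<eta>0: "\<eta>0 > 0" "\<And>y. dist y xbar < \<eta>0 \<Longrightarrow> dist (g y) (g xbar) < \<delta> / 4"
    using \<delta>(1) unfolding continuous_at_eps_delta dist_real_def by (metis zero_less_divide_iff zero_less_numeral)
  define \<eta> where "\<eta> = \<eta>0 / 2"
  define I where "I = {xbar - \<eta>..xbar + \<eta>}"
  have \<eta>: "\<eta> > 0" "\<And>y. y \<in> I \<Longrightarrow> g y \<le> g xbar + \<delta> / 4"
  proof -
    show "\<eta> > 0" using \<eta>0 by (simp add: \<eta>_def)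
    fix y assume "y \<in> I"
    then have "dist y xbar < \<eta>0" using \<eta>0(1) by (auto simp: I_def \<eta>_def dist_real_def abs_if field_simps)
    from \<eta>0(2)[OF this] show "g y \<le> g xbar + \<delta> / 4" unfolding dist_real_def by argo
  qed
  define T where "T n = (\<integral>y. indicator {y. \<bar>y\<bar> > M} y * ((\<bar>y\<bar> + xbar) * q n y) \<partial>lborel)" for n
  define E where "E n = M * (M + xbar) / \<eta> * exp (- (\<delta> / 2 * p n)) + T n / (2 * \<eta>)" for n
  have "E \<longlonglongrightarrow> M * (M + xbar) / \<eta> * 0 + 0 / (2 * \<eta>)"
    unfolding E_def
  proof (intro tendsto_add tendsto_mult tendsto_divide tendsto_const)
    have "filterlim (\<lambda>n. \<delta> / 2 * p n) at_top sequentially"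
      using \<delta>(1) by (intro filterlim_tendsto_pos_mult_at_top[OF tendsto_const _ p]) auto
    then show "(\<lambda>n. exp (- (\<delta> / 2 * p n))) \<longlonglongrightarrow> 0"
      by (intro filterlim_compose[OF exp_at_bot] filterlim_compose[OF filterlim_uminus_at_bot_at_top])
    show "T \<longlonglongrightarrow> 0" using tail by (simp add: T_def[abs_def])
  qed (use \<eta> in auto)
  then have "\<forall>\<^sub>F n in sequentially. E n < \<epsilon>" using \<epsilon> by (intro order_tendstoD) auto
  moreover have "\<forall>\<^sub>F n in sequentially. \<forall>y\<in>C. dist (F n y) (g y) < \<delta>"
    by (rule uniform_limitD[OF unif[OF C] \<delta>(1)])
  moreover have "\<forall>\<^sub>F n in sequentially. \<forall>y\<in>I. dist (F n y) (g y) < \<delta> / 4"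
    using \<delta>(1) by (intro uniform_limitD[OF unif]) (auto simp: I_def)
  moreover have "\<forall>\<^sub>F n in sequentially. p n \<ge> 0" using p by (auto simp: filterlim_at_top)
  moreover note int
  ultimately show "\<forall>\<^sub>F n in sequentially.
      dist ((\<integral>y. \<bar>\<bar>y\<bar> - xbar\<bar> * q n y \<partial>lborel) / (\<integral>y. q n y \<partial>lborel)) 0 < \<epsilon>0"
  proof eventually_elim
    case (elim n)
    have qpos: "q n y > 0" for y by (simp add: q_def)
    have q_int: "integrable lborel (q n)" and qa_int: "integrable lborel (\<lambda>y. \<bar>y\<bar> * q n y)"
      using elim by auto
    have [measurable]: "q n \<in> borel_measurable lborel" using q_int by auto
    define L where "L = exp (- (p n * (g xbar + \<delta> / 2)))"
    define U where "U = exp (- (p n * (g xbar + \<delta>)))"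
    define Z where "Z = (\<integral>y. q n y \<partial>lborel)"
    have L: "L \<ge> 1" using \<delta>(3) elim by (auto simp: L_def mult_nonneg_nonpos)
    have UL: "U = L * exp (- (\<delta> / 2 * p n))"
      by (simp add: U_def L_def algebra_simps flip: exp_add)
    have sum_int: "integrable lborel (\<lambda>y. (\<bar>y\<bar> + xbar) * q n y)"
      using q_int qa_int by (simp add: distrib_right)
    have tail_int: "integrable lborel (\<lambda>y. indicator {y. \<bar>y\<bar> > M} y * ((\<bar>y\<bar> + xbar) * q n y))"
      using integrable_mult_indicator[OF _ sum_int, of "{y. \<bar>y\<bar> > M}"] by simp
    have dev_int: "integrable lborel (\<lambda>y. \<bar>\<bar>y\<bar> - xbar\<bar> * q n y)"
    proof (rule Bochner_Integration.integrable_bound[OF sum_int])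
      show "AE y in lborel. norm (\<bar>\<bar>y\<bar> - xbar\<bar> * q n y) \<le> norm ((\<bar>y\<bar> + xbar) * q n y)"
        using qpos xbar by (intro AE_I2) (auto simp: abs_mult intro!: mult_right_mono)
    qed simp
    have I_int: "(\<integral>y. indicator I y * L \<partial>lborel) = 2 * \<eta> * L" "integrable lborel (\<lambda>y. indicator I y * L)"
      using \<eta>(1) by (simp_all add: I_def)
    have M_int: "(\<integral>y. indicator {-M..M} y * ((M + xbar) * U) \<partial>lborel) = 2 * M * ((M + xbar) * U)"
        "integrable lborel (\<lambda>y. indicator {-M..M} y * ((M + xbar) * U))"
      using M by simp_all
    have "2 * \<eta> * L \<le> Z"
      unfolding I_int(1)[symmetric] Z_def
    proof (rule integral_mono[OF I_int(2) q_int])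
      fix y
      show "indicator I y * L \<le> q n y"
      proof (cases "y \<in> I")
        case True
        then have "dist (F n y) (g y) < \<delta> / 4" "g y \<le> g xbar + \<delta> / 4" using elim \<eta> by auto
        then have "F n y \<le> g xbar + \<delta> / 2" unfolding dist_real_def by argo
        then have "p n * F n y \<le> p n * (g xbar + \<delta> / 2)" using elim by (intro mult_left_mono)
        then show ?thesis using True by (simp add: L_def q_def)
      qed (use qpos[of y] in simp)
    qed
    have Zpos: "Z > 0" using \<open>2 * \<eta> * L \<le> Z\<close> \<eta>(1) L mult_pos_pos[of "2 * \<eta>" L] by linarith
    have "(\<integral>y. \<bar>\<bar>y\<bar> - xbar\<bar> * q n y \<partial>lborel) \<le>
      (\<integral>y. \<epsilon> * q n y + indicator {-M..M} y * ((M + xbar) * U)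
          + indicator {y. \<bar>y\<bar> > M} y * ((\<bar>y\<bar> + xbar) * q n y) \<partial>lborel)"
    proof (rule integral_mono[OF dev_int])
      show "integrable lborel (\<lambda>y. \<epsilon> * q n y + indicator {-M..M} y * ((M + xbar) * U)
          + indicator {y. \<bar>y\<bar> > M} y * ((\<bar>y\<bar> + xbar) * q n y))"
        using q_int M_int(2) tail_int by (intro Bochner_Integration.integrable_add) auto
      fix y
      have nn: "0 \<le> \<epsilon> * q n y" "0 \<le> (M + xbar) * U" "\<bar>\<bar>y\<bar> - xbar\<bar> \<le> \<bar>y\<bar> + xbar"
        using \<epsilon> qpos[of y] M xbar by (auto simp: U_def)
      consider "\<bar>y\<bar> > M" | "\<bar>y\<bar> \<le> M" "\<bar>\<bar>y\<bar> - xbar\<bar> < \<epsilon>" | "y \<in> C"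
        unfolding C_def by (cases "\<bar>y\<bar> \<le> M"; cases "\<bar>\<bar>y\<bar> - xbar\<bar> < \<epsilon>") (auto simp: not_less abs_le_iff)
      then show "\<bar>\<bar>y\<bar> - xbar\<bar> * q n y \<le> \<epsilon> * q n y + indicator {-M..M} y * ((M + xbar) * U)
          + indicator {y. \<bar>y\<bar> > M} y * ((\<bar>y\<bar> + xbar) * q n y)"
      proof cases
        case 1
        have "\<bar>\<bar>y\<bar> - xbar\<bar> * q n y \<le> (\<bar>y\<bar> + xbar) * q n y"
          using nn qpos[of y] by (intro mult_right_mono) auto
        moreover have "y \<notin> {-M..M}" using 1 by auto
        ultimately show ?thesis using 1 nn by simp
      next
        case 2
        have "\<bar>\<bar>y\<bar> - xbar\<bar> * q n y \<le> \<epsilon> * q n y"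
          using 2 qpos[of y] by (intro mult_right_mono) auto
        moreover have "y \<in> {-M..M}" using 2 by auto
        ultimately show ?thesis using 2 nn by simp
      next
        case 3
        then have "dist (F n y) (g y) < \<delta>" "g y \<ge> g xbar + 2 * \<delta>" using elim \<delta> by auto
        then have "F n y \<ge> g xbar + \<delta>" unfolding dist_real_def by argo
        then have "p n * F n y \<ge> p n * (g xbar + \<delta>)" using elim by (intro mult_left_mono)
        then have "q n y \<le> U" by (simp add: U_def q_def)
        moreover have y: "\<bar>y\<bar> \<le> M" using 3 by (auto simp: C_def)
        ultimately have "\<bar>\<bar>y\<bar> - xbar\<bar> * q n y \<le> (M + xbar) * U"
          using nn qpos[of y] M xbar by (intro mult_mono) auto
        moreover have "y \<in> {-M..M}" using y by auto
        ultimately show ?thesis using y nn by simp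
      qed
    qed
    also have "\<dots> = \<epsilon> * Z + 2 * M * ((M + xbar) * U) + T n"
      unfolding M_int(1)[symmetric] Z_def T_def using q_int M_int(2) tail_int
      by (subst Bochner_Integration.integral_add | simp)+
    finally have "(\<integral>y. \<bar>\<bar>y\<bar> - xbar\<bar> * q n y \<partial>lborel) / Z \<le> (\<epsilon> * Z + 2 * M * ((M + xbar) * U) + T n) / Z"
      using Zpos by (intro divide_right_mono) auto
    also have "\<dots> = \<epsilon> + 2 * M * ((M + xbar) * U) / Z + T n / Z"
      using Zpos by (simp add: add_divide_distrib)
    also have "\<dots> \<le> \<epsilon> + 2 * M * ((M + xbar) * U) / (2 * \<eta> * L) + T n / (2 * \<eta>)"
    proof (intro add_mono order.refl divide_left_mono)
      have "2 * \<eta> * 1 \<le> 2 * \<eta> * L" using L \<eta> by (intro mult_left_mono) auto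
      then show "2 * \<eta> \<le> Z" using \<open>2 * \<eta> * L \<le> Z\<close> by simp
      have "\<bar>y\<bar> + xbar \<ge> 0" for y using xbar by simp
      then show "0 \<le> T n" unfolding T_def using qpos
        by (intro Bochner_Integration.integral_nonneg mult_nonneg_nonneg) (auto intro: less_imp_le)
      show "0 \<le> 2 * M * ((M + xbar) * U)" using M xbar by (simp add: U_def)
    qed (use \<open>2 * \<eta> * L \<le> Z\<close> Zpos \<eta> L in auto)
    also have "\<dots> = \<epsilon> + E n"
      using L \<eta> unfolding E_def UL by (simp add: field_simps)
    also have "\<dots> < \<epsilon>0" using elim by (simp add: \<epsilon>_def)
    finally have "(\<integral>y. \<bar>\<bar>y\<bar> - xbar\<bar> * q n y \<partial>lborel) / Z < \<epsilon>0" .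
    moreover have "(\<integral>y. \<bar>\<bar>y\<bar> - xbar\<bar> * q n y \<partial>lborel) / Z \<ge> 0"
      using Zpos qpos by (intro divide_nonneg_pos Bochner_Integration.integral_nonneg mult_nonneg_nonneg) (auto intro: less_imp_le)
    ultimately show ?case by (simp add: Z_def)
  qed
qed

section \<open>Scaling limits\<close>

lemma integrable_linear_gaussian:
  assumes "d > 0"
  shows "integrable lborel (\<lambda>y::real. (\<bar>y\<bar> + c) * exp (- (d * y\<^sup>2 / 2)))"
proof -
  define \<sigma> where "\<sigma> = 1 / sqrt d"
  have \<sigma>: "\<sigma> > 0" "\<sigma>\<^sup>2 = 1 / d" using assms by (simp_all add: \<sigma>_def power_divide)
  have N: "normal_density 0 \<sigma> y = sqrt (d / (2 * pi)) * exp (- (d * y\<^sup>2 / 2))" for y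
    using assms by (simp add: normal_density_def \<sigma> real_sqrt_divide mult.commute)
  have "integrable lborel (\<lambda>y. sqrt (2 * pi / d) * (normal_density 0 \<sigma> y * \<bar>y - 0\<bar> ^ 1 + c * normal_density 0 \<sigma> y))"
    using \<sigma> integrable_normal_moment_abs[OF \<sigma>(1), of 0 1] by simp
  also have "(\<lambda>y. sqrt (2 * pi / d) * (normal_density 0 \<sigma> y * \<bar>y - 0\<bar> ^ 1 + c * normal_density 0 \<sigma> y))
     = (\<lambda>y. (\<bar>y\<bar> + c) * exp (- (d * y\<^sup>2 / 2)))"
  proof
    fix y :: real
    have "sqrt (2 * pi / d) * sqrt (d / (2 * pi)) = 1"
      using assms by (simp flip: real_sqrt_mult)
    then have "sqrt (2 * pi / d) * normal_density 0 \<sigma> y = exp (- (d * y\<^sup>2 / 2))"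
      unfolding N mult.assoc[symmetric] by simp
    then show "sqrt (2 * pi / d) * (normal_density 0 \<sigma> y * \<bar>y - 0\<bar> ^ 1 + c * normal_density 0 \<sigma> y) = (\<bar>y\<bar> + c) * exp (- (d * y\<^sup>2 / 2))"
      by (simp add: algebra_simps)
  qed
  finally show ?thesis .
qed

text \<open>
  The tail splits at \<open>\<bar>y\<bar> = R n\<^sup>\<tau>\<close>. On the inner part \<open>q n\<close> is at most \<open>exp (- n\<^sup>\<gamma>)\<close>, which beats the
  polynomial length of that region. On the outer part half of the exponent yields the factor
  \<open>exp (- n d R\<^sup>2 / 2)\<close>; the other half dominates \<open>d y\<^sup>2 / 2\<close> because \<open>n\<^sup>1\<^sup>-\<^sup>2\<^sup>\<tau> \<ge> 1\<close>, and so leaves an integrable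
  Gaussian that is the same for all \<open>n\<close>.
\<close>

lemma tail_integral_tendsto_0:
  fixes q :: "nat \<Rightarrow> real \<Rightarrow> real"
  assumes \<tau>: "0 < \<tau>" "\<tau> < 1 / 2" and \<gamma>: "0 < \<gamma>"
    and params: "R > 0" "d > 0" "c > 0" "M > 0"
    and near: "\<forall>\<^sub>F n in sequentially. \<forall>y. M < \<bar>y\<bar> \<and> \<bar>y\<bar> < R * real n powr \<tau> \<longrightarrow> q n y \<le> exp (- (real n powr \<gamma>))"
    and far: "\<forall>\<^sub>F n in sequentially. \<forall>y. R * real n powr \<tau> \<le> \<bar>y\<bar> \<longrightarrow> q n y \<le> exp (- (real n * (d * (y / real n powr \<tau>)\<^sup>2)))"
    and q: "\<forall>\<^sub>F n in sequentially. (\<forall>y. 0 \<le> q n y) \<and> integrable lborel (q n) \<and> integrable lborel (\<lambda>y. \<bar>y\<bar> * q n y)"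
  shows "(\<lambda>n. \<integral>y. indicator {y. \<bar>y\<bar> > M} y * ((\<bar>y\<bar> + c) * q n y) \<partial>lborel) \<longlonglongrightarrow> 0"
proof -
  define J where "J = (\<integral>y. (\<bar>y\<bar> + c) * exp (- (d * y\<^sup>2 / 2)) \<partial>lborel)"
  define B where "B n = 2 * (R * real n powr \<tau>) * ((R * real n powr \<tau> + c) * exp (- (real n powr \<gamma>)))
      + exp (- (real n * (d * R\<^sup>2 / 2))) * J" for n
  have lim1: "(\<lambda>n. 2 * (R * real n powr \<tau>) * ((R * real n powr \<tau> + c) * exp (- (real n powr \<gamma>)))) \<longlonglongrightarrow> 0"
    using \<tau>(1) \<gamma> params by real_asymp
  have lim2: "(\<lambda>n. exp (- (real n * (d * R\<^sup>2 / 2)))) \<longlonglongrightarrow> 0"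
  proof -
    define D where "D = d * R\<^sup>2 / 2"
    have "D > 0" using params by (simp add: D_def)
    then show ?thesis unfolding D_def[symmetric] by real_asymp
  qed
  have B: "B \<longlonglongrightarrow> 0"
    using tendsto_add[OF lim1 tendsto_mult[OF lim2 tendsto_const[of J]]] by (simp add: B_def[abs_def])
  have "\<forall>\<^sub>F n in sequentially. (\<integral>y. indicator {y. \<bar>y\<bar> > M} y * ((\<bar>y\<bar> + c) * q n y) \<partial>lborel) \<le> B n"
    using near far q eventually_ge_at_top[of 1]
  proof eventually_elim
    case (elim n)
    define s where "s = real n powr \<tau>"
    have s: "s > 0" using elim by (simp add: s_def)
    have s2: "s\<^sup>2 \<le> real n"
    proof -
      have "s\<^sup>2 = real n powr (2 * \<tau>)" using elim by (simp add: s_def power2_eq_square flip: powr_add)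
      also have "\<dots> \<le> real n powr 1" using elim \<tau> by (intro powr_mono) auto
      finally show ?thesis using elim by simp
    qed
    have sum_int: "integrable lborel (\<lambda>y. (\<bar>y\<bar> + c) * q n y)"
      using elim by (simp add: distrib_right)
    have tail_int: "integrable lborel (\<lambda>y. indicator {y. \<bar>y\<bar> > M} y * ((\<bar>y\<bar> + c) * q n y))"
      using integrable_mult_indicator[OF _ sum_int, of "{y. \<bar>y\<bar> > M}"] by simp
    define a1 where "a1 = (R * s + c) * exp (- (real n powr \<gamma>))"
    define a2 where "a2 = exp (- (real n * (d * R\<^sup>2 / 2)))"
    have i1: "integrable lborel (\<lambda>y. indicator {- (R * s)..R * s} y * a1)"
      "(\<integral>y. indicator {- (R * s)..R * s} y * a1 \<partial>lborel) = 2 * (R * s) * a1"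
      using s params by simp_all
    have i2: "integrable lborel (\<lambda>y. a2 * ((\<bar>y\<bar> + c) * exp (- (d * y\<^sup>2 / 2))))"
      using integrable_linear_gaussian[OF params(2)] by (rule integrable_mult_right)
    have nn: "a1 \<ge> 0" "a2 \<ge> 0" using s params by (simp_all add: a1_def a2_def)
    have "(\<integral>y. indicator {y. \<bar>y\<bar> > M} y * ((\<bar>y\<bar> + c) * q n y) \<partial>lborel)
      \<le> (\<integral>y. indicator {- (R * s)..R * s} y * a1 + a2 * ((\<bar>y\<bar> + c) * exp (- (d * y\<^sup>2 / 2))) \<partial>lborel)"
    proof (rule integral_mono[OF tail_int Bochner_Integration.integrable_add[OF i1(1) i2]])
      fix y
      have nn': "0 \<le> a2 * ((\<bar>y\<bar> + c) * exp (- (d * y\<^sup>2 / 2)))" using nn params by simp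
      consider "\<bar>y\<bar> \<le> M" | "M < \<bar>y\<bar>" "\<bar>y\<bar> < R * s" | "M < \<bar>y\<bar>" "R * s \<le> \<bar>y\<bar>" by linarith
      then show "indicator {y. \<bar>y\<bar> > M} y * ((\<bar>y\<bar> + c) * q n y)
        \<le> indicator {- (R * s)..R * s} y * a1 + a2 * ((\<bar>y\<bar> + c) * exp (- (d * y\<^sup>2 / 2)))"
      proof cases
        case 1 then show ?thesis using nn nn' by (simp add: indicator_def)
      next
        case 2
        then have "q n y \<le> exp (- (real n powr \<gamma>))" using elim by (simp add: s_def)
        then have "(\<bar>y\<bar> + c) * q n y \<le> a1"
          unfolding a1_def using 2 elim params by (intro mult_mono) auto
        moreover have "y \<in> {- (R * s)..R * s}" using 2 by auto
        ultimately show ?thesis using nn' 2 by simp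
      next
        case 3
        have "R \<le> \<bar>y / s\<bar>" using 3 s by (simp add: field_simps)
        then have "R\<^sup>2 \<le> (y / s)\<^sup>2" using params power_mono[of R "\<bar>y / s\<bar>" 2] unfolding power2_abs by simp
        then have e1: "real n * (d * R\<^sup>2 / 2) \<le> real n * (d * (y / s)\<^sup>2) / 2"
          using params by (simp add: mult_left_mono)
        have "s\<^sup>2 * (d * (y / s)\<^sup>2) \<le> real n * (d * (y / s)\<^sup>2)"
          using s2 params by (intro mult_right_mono) auto
        moreover have "s\<^sup>2 * (d * (y / s)\<^sup>2) = d * y\<^sup>2" using s by (simp add: power_divide)
        ultimately have "- (real n * (d * (y / s)\<^sup>2)) \<le> - (real n * (d * R\<^sup>2 / 2)) + - (d * y\<^sup>2 / 2)"
          using e1 by linarith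
        then have "exp (- (real n * (d * (y / s)\<^sup>2))) \<le> a2 * exp (- (d * y\<^sup>2 / 2))"
          unfolding a2_def exp_add[symmetric] by simp
        moreover have "q n y \<le> exp (- (real n * (d * (y / s)\<^sup>2)))" using elim 3 by (simp add: s_def)
        ultimately have "(\<bar>y\<bar> + c) * q n y \<le> (\<bar>y\<bar> + c) * (a2 * exp (- (d * y\<^sup>2 / 2)))"
          using params by (intro mult_left_mono) auto
        moreover have "0 \<le> indicator {- (R * s)..R * s} y * a1" using nn by simp
        ultimately show ?thesis using 3 by (simp add: mult_ac)
      qed
    qed
    also have "\<dots> = B n"
      using i1 i2 by (simp add: B_def a1_def a2_def s_def J_def)
    finally show ?case .
  qed
  moreover have "\<forall>\<^sub>F n in sequentially. 0 \<le> (\<integral>y. indicator {y. \<bar>y\<bar> > M} y * ((\<bar>y\<bar> + c) * q n y) \<partial>lborel)"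
    using q
  proof eventually_elim
    case (elim n)
    then show ?case using params
      by (intro Bochner_Integration.integral_nonneg mult_nonneg_nonneg) auto
  qed
  ultimately show ?thesis by (intro tendsto_sandwich[OF _ _ tendsto_const B])
qed

text \<open>
  Both scaling limits for one fixed sequence of parameters, with \<open>\<tau> = \<theta> \<alpha>\<close> and \<open>\<kappa> = \<alpha> / \<alpha>\<^sub>0\<close>. In the
  variable \<open>y = n\<^sup>\<tau> x\<close> the exponent is \<open>n G = n\<^sup>1\<^sup>-\<^sup>\<kappa> F\<close>, and \<open>F\<close> converges to \<open>g\<close> while the factor in front
  diverges; this is the situation of Laplace's method.
\<close>

lemma free_energy_scaling_limits:
  fixes bs Ks :: "nat \<Rightarrow> real" and g H :: "real \<Rightarrow> real" and \<kappa> \<tau> :: real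
  defines "F \<equiv> \<lambda>n y. real n powr \<kappa> * free_energy (bs n) (Ks n) (y / real n powr \<tau>)"
  assumes beta: "0 < \<beta>" "\<beta> \<le> beta_crit"
    and pos: "\<And>n. n \<ge> 1 \<Longrightarrow> bs n > 0 \<and> Ks n > 0"
    and conv: "(\<lambda>n. (bs n, Ks n)) \<longlonglongrightarrow> (\<beta>, K_crit \<beta>)"
    and exponents: "\<kappa> < 1" "0 < \<tau>" "\<tau> < 1 / 2"
    and unif: "\<And>C. compact C \<Longrightarrow> uniform_limit C F g sequentially"
    and cont: "continuous_on UNIV g"
    and xbar: "xbar > 0" "global_min_points g = {xbar, - xbar}"
    and H: "filterlim H at_top at_infinity"
    and R: "R > 0"
    and lower: "\<forall>\<^sub>F n in sequentially. \<forall>y. \<bar>y / real n powr \<tau>\<bar> < R \<longrightarrow> F n y \<ge> H y"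
  shows "(\<lambda>n. real n powr \<tau> * mean_abs_spin n (bs n) (Ks n)) \<longlonglongrightarrow> xbar"
    and "\<forall>\<^sub>F n in sequentially. (bs n, Ks n) \<in> phase_coexistence \<Longrightarrow>
       (\<lambda>n. real n powr \<tau> * magnetization (bs n) (Ks n)) \<longlonglongrightarrow> xbar"
proof -
  obtain d where d: "d > 0" and ev: "\<forall>\<^sub>F p in nhds (\<beta>, K_crit \<beta>). \<forall>x. \<bar>x\<bar> \<ge> R \<longrightarrow> free_energy (fst p) (snd p) x \<ge> d * x\<^sup>2"
    using free_energy_quadratic_lower_bound[OF beta R] by blast
  have outer: "\<forall>\<^sub>F n in sequentially. \<forall>x. \<bar>x\<bar> \<ge> R \<longrightarrow> free_energy (bs n) (Ks n) x \<ge> d * x\<^sup>2"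
    using eventually_compose_filterlim[OF ev conv] by simp
  have "\<forall>\<^sub>F y in at_infinity. H y \<ge> 1" using H by (simp add: filterlim_at_top)
  then obtain M0 where M0: "\<And>y. \<bar>y\<bar> \<ge> M0 \<Longrightarrow> H y \<ge> 1" by (auto simp: eventually_at_infinity)
  define M where "M = max M0 1"
  have M: "M > 0" "\<And>y. \<bar>y\<bar> \<ge> M \<Longrightarrow> H y \<ge> 1" using M0 by (auto simp: M_def)
  \<comment> \<open>The limit \<open>g\<close> vanishes at \<open>0\<close>, which is not a minimum point of \<open>g\<close>; hence its minimum is negative.\<close>
  have F0: "F n 0 = 0" for n by (simp add: F_def)
  have "(\<lambda>n. F n 0) \<longlonglongrightarrow> g 0" by (rule tendsto_uniform_limitI[OF unif[of "{0}"]]) auto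
  then have g0: "g 0 = 0" unfolding F0 by (rule LIMSEQ_unique[OF _ tendsto_const])
  obtain \<delta> where "\<delta> > 0" "\<forall>y\<in>{0}. g y \<ge> g xbar + \<delta>"
    using minimizer_gap[OF cont, of "{0}" xbar] xbar by auto
  then have gneg: "g xbar < 0" using g0 by simp

  show "(\<lambda>n. real n powr \<tau> * magnetization (bs n) (Ks n)) \<longlonglongrightarrow> xbar"
    if coex: "\<forall>\<^sub>F n in sequentially. (bs n, Ks n) \<in> phase_coexistence"
  proof (rule minimizers_tendsto[OF unif cont xbar])
    show "\<forall>\<^sub>F n in sequentially. 0 \<le> real n powr \<tau> * magnetization (bs n) (Ks n) \<and>
      real n powr \<tau> * magnetization (bs n) (Ks n) \<le> M \<and>
      F n (real n powr \<tau> * magnetization (bs n) (Ks n)) \<le> F n xbar"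
      using coex outer lower eventually_ge_at_top[of 1]
    proof eventually_elim
      case (elim n)
      define m where "m = magnetization (bs n) (Ks n)"
      define s where "s = real n powr \<tau>"
      have s: "s > 0" using elim by (simp add: s_def)
      have m: "m > 0" "\<And>y. free_energy (bs n) (Ks n) m \<le> free_energy (bs n) (Ks n) y"
        using magnetization_phase_coexistence[OF elim(1)] by (auto simp: m_def global_min_points_def)
      have "s * m / s = m" using s by simp
      have Fm: "F n (s * m) \<le> F n y" for y
        unfolding F_def s_def[symmetric] \<open>s * m / s = m\<close> by (intro mult_left_mono m) auto
      \<comment> \<open>The free energy is at most \<open>0\<close> at \<open>m\<close>, but positive wherever \<open>\<bar>x\<bar> \<ge> R\<close>.\<close>
      have "m < R"
      proof (rule ccontr)
        assume "\<not> m < R"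
        then have "d * m\<^sup>2 \<le> free_energy (bs n) (Ks n) m" using elim m by auto
        also have "\<dots> \<le> 0" using m(2)[of 0] by simp
        finally show False using d m by (simp add: mult_le_0_iff)
      qed
      \<comment> \<open>A bound on the scaled minimum points: \<open>H\<close> is nonpositive there and at least \<open>1\<close> beyond \<open>M\<close>.\<close>
      then have "H (s * m) \<le> F n (s * m)"
        using elim(3) m(1) \<open>s * m / s = m\<close> unfolding s_def[symmetric] by (metis abs_of_pos)
      also have "\<dots> \<le> 0" using Fm[of 0] F0 by simp
      finally have "\<not> M \<le> \<bar>s * m\<bar>" using M(2)[of "s * m"] by auto
      then show ?case using Fm m s by (auto simp: m_def[symmetric] s_def[symmetric])
    qed
  qed

  define p where "p n = real n powr (1 - \<kappa>)" for n
  have p: "filterlim p at_top sequentially"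
    unfolding p_def using exponents by real_asymp
  have pF: "p n * F n y = real n * free_energy (bs n) (Ks n) (y / real n powr \<tau>)" if "n \<ge> 1" for n y
    using that by (simp add: p_def F_def flip: powr_add mult.assoc)
  define q where "q n y = exp (- p n * F n y)" for n y
  have q_eq: "q n = (\<lambda>y. exp (- real n * free_energy (bs n) (Ks n) (y / real n powr \<tau>)))" if "n \<ge> 1" for n
    using pF[OF that] by (simp add: q_def fun_eq_iff)
  have int: "\<forall>\<^sub>F n in sequentially. integrable lborel (q n) \<and> integrable lborel (\<lambda>y. \<bar>y\<bar> * q n y)"
    using eventually_ge_at_top[of 1]
  proof eventually_elim
    case (elim n)
    then show ?case using mean_abs_spin_deviation_le(1,2)[OF elim, of "bs n" "Ks n" "real n powr \<tau>"] pos[OF elim]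
      by (simp add: q_eq)
  qed
  have tail: "(\<lambda>n. \<integral>y. indicator {y. \<bar>y\<bar> > M} y * ((\<bar>y\<bar> + xbar) * q n y) \<partial>lborel) \<longlonglongrightarrow> 0"
  proof (rule tail_integral_tendsto_0[where \<tau> = \<tau> and \<gamma> = "1 - \<kappa>" and R = R and d = d])
    show "\<forall>\<^sub>F n in sequentially. \<forall>y. M < \<bar>y\<bar> \<and> \<bar>y\<bar> < R * real n powr \<tau> \<longrightarrow> q n y \<le> exp (- (real n powr (1 - \<kappa>)))"
      using lower eventually_ge_at_top[of 1]
    proof eventually_elim
      case (elim n)
      show ?case
      proof (intro allI impI)
        fix y assume y: "M < \<bar>y\<bar> \<and> \<bar>y\<bar> < R * real n powr \<tau>"
        then have "\<bar>y / real n powr \<tau>\<bar> < R" using elim by (simp add: divide_less_eq)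
        then have "1 \<le> F n y" using elim y M(2)[of y] by fastforce
        then have "p n * 1 \<le> p n * F n y" by (intro mult_left_mono) (auto simp: p_def)
        then show "q n y \<le> exp (- (real n powr (1 - \<kappa>)))" by (simp add: q_def p_def)
      qed
    qed
    show "\<forall>\<^sub>F n in sequentially. \<forall>y. R * real n powr \<tau> \<le> \<bar>y\<bar> \<longrightarrow> q n y \<le> exp (- (real n * (d * (y / real n powr \<tau>)\<^sup>2)))"
      using outer eventually_ge_at_top[of 1]
    proof eventually_elim
      case (elim n)
      show ?case
      proof (intro allI impI)
        fix y assume y: "R * real n powr \<tau> \<le> \<bar>y\<bar>"
        then have "R \<le> \<bar>y / real n powr \<tau>\<bar>" using elim by (simp add: le_divide_eq)
        then have "d * (y / real n powr \<tau>)\<^sup>2 \<le> free_energy (bs n) (Ks n) (y / real n powr \<tau>)"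
          using elim by blast
        then have "real n * (d * (y / real n powr \<tau>)\<^sup>2) \<le> real n * free_energy (bs n) (Ks n) (y / real n powr \<tau>)"
          by (intro mult_left_mono) auto
        then show "q n y \<le> exp (- (real n * (d * (y / real n powr \<tau>)\<^sup>2)))"
          by (simp add: q_eq[OF elim(2)])
      qed
    qed
    show "\<forall>\<^sub>F n in sequentially. (\<forall>y. 0 \<le> q n y) \<and> integrable lborel (q n) \<and> integrable lborel (\<lambda>y. \<bar>y\<bar> * q n y)"
      using int by eventually_elim (simp add: q_def)
  qed (use exponents R d M xbar in auto)
  have lap: "(\<lambda>n. (\<integral>y. \<bar>\<bar>y\<bar> - xbar\<bar> * q n y \<partial>lborel) / (\<integral>y. q n y \<partial>lborel)) \<longlonglongrightarrow> 0"
    using laplace_concentration[OF unif cont xbar gneg p _ M(1)] int tail unfolding q_def by blast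
  \<comment> \<open>The rescaled Gaussian noise has standard deviation of order \<open>n powr (\<tau> - 1 / 2)\<close>.\<close>
  have "(\<lambda>n. real n powr (\<tau> - 1 / 2) * (1 / sqrt (2 * bs n * Ks n)) * sqrt (2 / pi)) \<longlonglongrightarrow> 0 * (1 / sqrt (2 * \<beta> * K_crit \<beta>)) * sqrt (2 / pi)"
  proof (intro tendsto_intros)
    show "(\<lambda>n. real n powr (\<tau> - 1 / 2)) \<longlonglongrightarrow> 0" using exponents by real_asymp
    show "bs \<longlonglongrightarrow> \<beta>" "Ks \<longlonglongrightarrow> K_crit \<beta>" using tendsto_fst[OF conv] tendsto_snd[OF conv] by simp_all
    have "K_crit \<beta> > 0" using beta by (auto simp: K_crit_def intro!: divide_pos_pos add_pos_pos)
    then show "sqrt (2 * \<beta> * K_crit \<beta>) \<noteq> 0" using beta by simp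
  qed
  from tendsto_add[OF lap this]
  have lim: "(\<lambda>n. (\<integral>y. \<bar>\<bar>y\<bar> - xbar\<bar> * q n y \<partial>lborel) / (\<integral>y. q n y \<partial>lborel)
      + real n powr (\<tau> - 1 / 2) * (1 / sqrt (2 * bs n * Ks n)) * sqrt (2 / pi)) \<longlonglongrightarrow> 0" by simp
  have "\<forall>\<^sub>F n in sequentially. norm (real n powr \<tau> * mean_abs_spin n (bs n) (Ks n) - xbar)
     \<le> (\<integral>y. \<bar>\<bar>y\<bar> - xbar\<bar> * q n y \<partial>lborel) / (\<integral>y. q n y \<partial>lborel)
      + real n powr (\<tau> - 1 / 2) * (1 / sqrt (2 * bs n * Ks n)) * sqrt (2 / pi)"
    using eventually_ge_at_top[of 1]
  proof eventually_elim
    case (elim n)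
    have "real n powr \<tau> / sqrt (2 * bs n * Ks n * real n) = real n powr (\<tau> - 1 / 2) * (1 / sqrt (2 * bs n * Ks n))"
      using elim by (simp add: real_sqrt_mult powr_diff powr_half_sqrt)
    then show ?case
      using mean_abs_spin_deviation_le(3)[OF elim, of "bs n" "Ks n" "real n powr \<tau>" xbar] pos[OF elim] elim
      by (simp add: q_eq)
  qed
  then have "(\<lambda>n. real n powr \<tau> * mean_abs_spin n (bs n) (Ks n) - xbar) \<longlonglongrightarrow> 0"
    by (rule Lim_null_comparison[OF _ lim])
  then show "(\<lambda>n. real n powr \<tau> * mean_abs_spin n (bs n) (Ks n)) \<longlonglongrightarrow> xbar"
    by (rule LIM_zero_cancel)
qed

theorem theorem4p1:
  fixes \<beta> :: real
    and \<beta>s Ks :: "real \<Rightarrow> nat \<Rightarrow> real"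
    and g H :: "real poly"
    and \<alpha>\<^sub>0 \<theta> xbar :: real
  assumes beta: "0 < \<beta>" "\<beta> \<le> beta_crit"
    and pos: "\<And>\<alpha> n. \<alpha> > 0 \<Longrightarrow> n \<ge> 1 \<Longrightarrow> \<beta>s \<alpha> n > 0 \<and> Ks \<alpha> n > 0"
    and conv: "\<And>\<alpha>. \<alpha> > 0 \<Longrightarrow> (\<lambda>n. (\<beta>s \<alpha> n, Ks \<alpha> n)) \<longlonglongrightarrow> (\<beta>, K_crit \<beta>)"
    and hyp_i: "\<And>\<alpha>. \<alpha> > 0 \<Longrightarrow> \<forall>\<^sub>F n in sequentially. (\<beta>s \<alpha> n, Ks \<alpha> n) \<in> phase_coexistence"
    and hyp_ii: "\<And>\<alpha>. \<alpha> > 0 \<Longrightarrow>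
      \<exists>b k. (\<lambda>n. real n powr \<alpha> * (\<beta>s \<alpha> n - \<beta>)) \<longlonglongrightarrow> b
          \<and> (\<lambda>n. real n powr \<alpha> * (Ks \<alpha> n - K_crit \<beta>)) \<longlonglongrightarrow> k
          \<and> \<not> (b = 0 \<and> k = 0)
          \<and> (b \<noteq> 0 \<longrightarrow> b \<in> {1, -1})"
    and g_even: "\<And>x. poly g (- x) = poly g x"
    and g_degree: "degree g = 4 \<or> degree g = 6"
    and g_infinity: "filterlim (poly g) at_top at_infinity"
    and exponents: "\<alpha>\<^sub>0 > 0" "\<theta> > 0"
    and hyp_iii_a: "\<And>\<alpha> C. 0 < \<alpha> \<Longrightarrow> \<alpha> < \<alpha>\<^sub>0 \<Longrightarrow> compact C \<Longrightarrow>
      uniform_limit C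
        (\<lambda>n x. real n powr (\<alpha> / \<alpha>\<^sub>0) * free_energy (\<beta>s \<alpha> n) (Ks \<alpha> n) (x / real n powr (\<theta> * \<alpha>)))
        (poly g) sequentially"
    and hyp_iii_b: "xbar > 0" "global_min_points (poly g) = {xbar, - xbar}"
    and H_infinity: "filterlim (poly H) at_top at_infinity"
    and hyp_iv: "\<And>\<alpha>. 0 < \<alpha> \<Longrightarrow> \<alpha> < \<alpha>\<^sub>0 \<Longrightarrow>
      \<exists>R>0. \<forall>\<^sub>F n in sequentially. \<forall>x. \<bar>x / real n powr (\<theta> * \<alpha>)\<bar> < R \<longrightarrow>
        real n powr (\<alpha> / \<alpha>\<^sub>0) * free_energy (\<beta>s \<alpha> n) (Ks \<alpha> n) (x / real n powr (\<theta> * \<alpha>)) \<ge> poly H x"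
    and theta_alpha0: "0 < \<theta> * \<alpha>\<^sub>0" "\<theta> * \<alpha>\<^sub>0 < 1 / 2"
  shows "(\<forall>\<alpha>. 0 < \<alpha> \<and> \<alpha> < \<alpha>\<^sub>0 \<longrightarrow>
            (\<lambda>n. mean_abs_spin n (\<beta>s \<alpha> n) (Ks \<alpha> n)) \<sim>[sequentially]
              (\<lambda>n. xbar / real n powr (\<theta> * \<alpha>)) \<and>
            (\<lambda>n. real n powr (\<theta> * \<alpha>) * mean_abs_spin n (\<beta>s \<alpha> n) (Ks \<alpha> n)) \<longlonglongrightarrow> xbar) \<and>
         (\<forall>\<alpha>. 0 < \<alpha> \<and> \<alpha> < \<alpha>\<^sub>0 \<longrightarrow>
            (\<lambda>n. mean_abs_spin n (\<beta>s \<alpha> n) (Ks \<alpha> n)) \<sim>[sequentially]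
              (\<lambda>n. magnetization (\<beta>s \<alpha> n) (Ks \<alpha> n)))"
proof (intro conjI allI impI)
  fix \<alpha> assume \<alpha>: "0 < \<alpha> \<and> \<alpha> < \<alpha>\<^sub>0"
  define \<tau> where "\<tau> = \<theta> * \<alpha>"
  obtain R where R: "R > 0" "\<forall>\<^sub>F n in sequentially. \<forall>x. \<bar>x / real n powr \<tau>\<bar> < R \<longrightarrow>
        real n powr (\<alpha> / \<alpha>\<^sub>0) * free_energy (\<beta>s \<alpha> n) (Ks \<alpha> n) (x / real n powr \<tau>) \<ge> poly H x"
    using hyp_iv[of \<alpha>] \<alpha> unfolding \<tau>_def by blast
  have \<tau>: "0 < \<tau>" "\<tau> < 1 / 2"
  proof -
    show "0 < \<tau>" using \<alpha> exponents by (simp add: \<tau>_def)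
    have "\<tau> < \<theta> * \<alpha>\<^sub>0" using \<alpha> exponents by (simp add: \<tau>_def)
    then show "\<tau> < 1 / 2" using theta_alpha0 by simp
  qed
  have \<kappa>: "\<alpha> / \<alpha>\<^sub>0 < 1" using \<alpha> by (simp add: divide_less_eq)
  have cont: "continuous_on UNIV (poly g)" by (intro continuous_intros)
  have pos': "\<beta>s \<alpha> n > 0 \<and> Ks \<alpha> n > 0" if "n \<ge> 1" for n using pos \<alpha> that by blast
  have unif: "uniform_limit C
      (\<lambda>n x. real n powr (\<alpha> / \<alpha>\<^sub>0) * free_energy (\<beta>s \<alpha> n) (Ks \<alpha> n) (x / real n powr \<tau>))
      (poly g) sequentially" if "compact C" for C
    unfolding \<tau>_def using \<alpha> that by (intro hyp_iii_a) auto
  note limits = free_energy_scaling_limits[OF beta pos' conv \<kappa> \<tau> unif cont hyp_iii_b H_infinity R]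
  have mean: "(\<lambda>n. real n powr \<tau> * mean_abs_spin n (\<beta>s \<alpha> n) (Ks \<alpha> n)) \<longlonglongrightarrow> xbar"
    using limits(1) \<alpha> by blast
  have mag: "(\<lambda>n. real n powr \<tau> * magnetization (\<beta>s \<alpha> n) (Ks \<alpha> n)) \<longlonglongrightarrow> xbar"
    using limits(2) hyp_i \<alpha> by blast
  show "(\<lambda>n. real n powr (\<theta> * \<alpha>) * mean_abs_spin n (\<beta>s \<alpha> n) (Ks \<alpha> n)) \<longlonglongrightarrow> xbar"
    using mean by (simp add: \<tau>_def)
  have "(\<lambda>n. real n powr \<tau> * mean_abs_spin n (\<beta>s \<alpha> n) (Ks \<alpha> n) / xbar) \<longlonglongrightarrow> 1"
    using tendsto_divide[OF mean tendsto_const[of xbar]] hyp_iii_b(1) by simp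
  then show "(\<lambda>n. mean_abs_spin n (\<beta>s \<alpha> n) (Ks \<alpha> n)) \<sim>[sequentially] (\<lambda>n. xbar / real n powr (\<theta> * \<alpha>))"
    by (intro asymp_equivI') (simp add: \<tau>_def mult.commute)
  have "(\<lambda>n. (real n powr \<tau> * mean_abs_spin n (\<beta>s \<alpha> n) (Ks \<alpha> n)) /
      (real n powr \<tau> * magnetization (\<beta>s \<alpha> n) (Ks \<alpha> n))) \<longlonglongrightarrow> 1"
    using tendsto_divide[OF mean mag] hyp_iii_b(1) by simp
  then have "(\<lambda>n. mean_abs_spin n (\<beta>s \<alpha> n) (Ks \<alpha> n) / magnetization (\<beta>s \<alpha> n) (Ks \<alpha> n)) \<longlonglongrightarrow> 1"
  proof (rule Lim_transform_eventually)
    show "\<forall>\<^sub>F n in sequentially. (real n powr \<tau> * mean_abs_spin n (\<beta>s \<alpha> n) (Ks \<alpha> n)) /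
        (real n powr \<tau> * magnetization (\<beta>s \<alpha> n) (Ks \<alpha> n))
      = mean_abs_spin n (\<beta>s \<alpha> n) (Ks \<alpha> n) / magnetization (\<beta>s \<alpha> n) (Ks \<alpha> n)"
      using eventually_gt_at_top[of 0] by eventually_elim simp
  qed
  then show "(\<lambda>n. mean_abs_spin n (\<beta>s \<alpha> n) (Ks \<alpha> n)) \<sim>[sequentially]
      (\<lambda>n. magnetization (\<beta>s \<alpha> n) (Ks \<alpha> n))"
    by (rule asymp_equivI')
qed

end
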